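(* Let $d\ge 3$ and let $X\sim f(\|x-\theta\|^2)$, $x,\theta\in\mathbb{R}^d$, be a scale mixture of normals, i.e. $X\mid V\sim N_d(\theta,V I_d)$ with a positive mixing variable $V$. Let $0\le\omega<1$ and let $\ell(\cdot)\ge 0$ with $\ell'(\cdot)>0$ and $\ell'$ completely monotone on $\mathbb{R}_+$. Assume that $f_0^*(x)=\ell'((1-\omega)\|x\|^2)\,f(\|x\|^2)/K_1$ is a density on $\mathbb{R}^d$ (with $K_1$ the normalizing constant), let $\mathbb{E}_{0,\omega}^{*}$ denote expectation when $X$ has density $f_0^*$, and suppose $\mathbb{E}_{0,\omega}^{*}[\|X\|^2]$ and $\mathbb{E}_{0,\omega}^{*}[1/\|X\|^2]$ are finite. Let $$\delta_{a(1-\omega),r(\cdot)}(X)=\left(1-\frac{a(1-\omega)\,r(\|X\|^2)}{\|X\|^2}\right)X,$$ where $0\le r(\cdot)\le 1$, $r(\cdot)$ is not identically $0$, $r'(\cdot)\ge 0$, $\frac{d}{dt}\left(\frac{r(t)}{t}\right)\le 0$, and $$0<a<\frac{2}{\mathbb{E}_{0,\omega}^{*}\left(\frac{1}{\|X\|^2}\right)}$$ (these being sufficient requirements for $\delta_{a(1-\omega),r(\cdot)}(X)$ to dominate $X$ under the loss $\ell(\omega\|\delta-X\|^2+(1-\omega)\|\delta-\theta\|^2)$). Then $\delta_{a(1-\omega),r(\cdot)}(X)$ also dominates $\delta_0(X)=X$ under the original balanced loss $$L_{\omega,\ell_0}(\theta,\delta)=\omega\,\|\delta-X\|^2+(1-\omega)\,\|\delta-\theta\|^2,\qquad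 \ell_0(t)=t.$$
   Context: The notation $X\sim f(\|x-\theta\|^2)$ means that $X$ has Lebesgue density $x\mapsto f(\|x-\theta\|^2)$ on $\mathbb{R}^d$; $\mathbb{E}_\theta$ is expectation under this density. Complete monotonicity of $\ell'$ means $(-1)^k\ell^{(k+1)}(t)\ge 0$ for all $t>0$ and $k=0,1,\ldots$. Under a loss $L$, the frequentist risk of an estimator $\delta(X)$ is $R(\theta,\delta)=\mathbb{E}_\theta[L(\theta,\delta(X))]$. An estimator $\delta_1$ dominates $\delta_2$ if $R(\theta,\delta_1)\le R(\theta,\delta_2)$ for all $\theta\in\mathbb{R}^d$ with strict inequality for at least one $\theta$. Moment finiteness convention: the risks being compared are assumed finite. *)

theory Defs
  imports "HOL-Probability.Probability"
begin

definition normal_law :: "real ^ 'd \<Rightarrow> real \<Rightarrow> (real ^ 'd) measure" where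
  "normal_law \<theta> v = density lborel
     (\<lambda>x. ennreal (1 / sqrt (2 * pi * v) ^ CARD('d) * exp (- (norm (x - \<theta>))\<^sup>2 / (2 * v))))"

definition spherical_law :: "(real \<Rightarrow> real) \<Rightarrow> real ^ 'd \<Rightarrow> (real ^ 'd) measure" where
  "spherical_law f \<theta> = density lborel (\<lambda>x. ennreal (f ((norm (x - \<theta>))\<^sup>2)))"

text \<open>The measure \<open>G\<close> is the distribution of the mixing variable \<open>V\<close>. The mixture is an
  identity of laws, so \<open>f\<close> may be any version of the density; in particular the mixture
  density is allowed to be infinite at its centre.\<close>

definition normal_scale_mixture :: "(real ^ 'd \<Rightarrow> (real ^ 'd) measure) \<Rightarrow> bool" where
  "normal_scale_mixture P \<longleftrightarrow>
     (\<exists>G :: real measure. prob_space G \<and> sets G = sets borel \<and> (AE v in G. 0 < v) \<and>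
       (\<forall>\<theta>. \<forall>A \<in> sets borel. emeasure (P \<theta>) A = (\<integral>\<^sup>+ v. emeasure (normal_law \<theta> v) A \<partial>G)))"

definition completely_monotone :: "(real \<Rightarrow> real) \<Rightarrow> bool" where
  "completely_monotone g \<longleftrightarrow>
     (\<forall>k. \<forall>t>0. (deriv ^^ k) g differentiable (at t) \<and> 0 \<le> (-1) ^ k * (deriv ^^ k) g t)"

definition K1 :: "(real \<Rightarrow> real) \<Rightarrow> (real \<Rightarrow> real) \<Rightarrow> real \<Rightarrow> 'd::finite itself \<Rightarrow> real" where
  "K1 f l \<omega> _ =
     (\<integral>x. deriv l ((1 - \<omega>) * (norm x)\<^sup>2) * f ((norm x)\<^sup>2) \<partial>(lborel :: (real ^ 'd) measure))"

definition f_star :: "(real \<Rightarrow> real) \<Rightarrow> (real \<Rightarrow> real) \<Rightarrow> real \<Rightarrow> real ^ 'd \<Rightarrow> real" where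
  "f_star f l \<omega> x =
     deriv l ((1 - \<omega>) * (norm x)\<^sup>2) * f ((norm x)\<^sup>2) / K1 f l \<omega> TYPE('d)"

definition star_law :: "(real \<Rightarrow> real) \<Rightarrow> (real \<Rightarrow> real) \<Rightarrow> real \<Rightarrow> (real ^ 'd) measure" where
  "star_law f l \<omega> = density lborel (\<lambda>x. ennreal (f_star f l \<omega> x))"

text \<open>A balanced loss depends on the observation \<open>x\<close> as well as on the parameter \<open>\<theta>\<close> and
  the estimate \<open>e\<close>.\<close>

definition balanced_loss ::
    "real \<Rightarrow> (real \<Rightarrow> real) \<Rightarrow> real ^ 'd \<Rightarrow> real ^ 'd \<Rightarrow> real ^ 'd \<Rightarrow> real" where
  "balanced_loss \<omega> l x \<theta> e = l (\<omega> * (norm (e - x))\<^sup>2 + (1 - \<omega>) * (norm (e - \<theta>))\<^sup>2)"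

definition risk ::
    "(real ^ 'd \<Rightarrow> (real ^ 'd) measure) \<Rightarrow> (real ^ 'd \<Rightarrow> real ^ 'd \<Rightarrow> real ^ 'd \<Rightarrow> real)
      \<Rightarrow> real ^ 'd \<Rightarrow> (real ^ 'd \<Rightarrow> real ^ 'd) \<Rightarrow> ennreal" where
  "risk P L \<theta> \<delta> = (\<integral>\<^sup>+ x. ennreal (L x \<theta> (\<delta> x)) \<partial>P \<theta>)"

definition dominates ::
    "(real ^ 'd \<Rightarrow> (real ^ 'd) measure) \<Rightarrow> (real ^ 'd \<Rightarrow> real ^ 'd \<Rightarrow> real ^ 'd \<Rightarrow> real)
      \<Rightarrow> (real ^ 'd \<Rightarrow> real ^ 'd) \<Rightarrow> (real ^ 'd \<Rightarrow> real ^ 'd) \<Rightarrow> bool" where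
  "dominates P L \<delta>\<^sub>1 \<delta>\<^sub>2 \<longleftrightarrow>
     (\<forall>\<theta>. risk P L \<theta> \<delta>\<^sub>1 \<le> risk P L \<theta> \<delta>\<^sub>2) \<and> (\<exists>\<theta>. risk P L \<theta> \<delta>\<^sub>1 < risk P L \<theta> \<delta>\<^sub>2)"

definition shrinkage :: "real \<Rightarrow> (real \<Rightarrow> real) \<Rightarrow> real ^ 'd \<Rightarrow> real ^ 'd" where
  "shrinkage c r x = (1 - c * r ((norm x)\<^sup>2) / (norm x)\<^sup>2) *\<^sub>R x"

end

theory Submission
  imports Defs "HOL-Real_Asymp.Real_Asymp"
begin

text \<open>
  Put \<open>w x = r ((norm x)\<^sup>2) / (norm x)\<^sup>2\<close>. Since \<open>(w x)\<^sup>2 * (norm x)\<^sup>2 \<le> w x\<close>, the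
  balanced loss of the shrinkage estimator exceeds that of \<open>x\<close> by at most
  \<open>(1 - \<omega>)\<^sup>2 * (a\<^sup>2 * w x - 2 * a * w x * (x \<bullet> (x - \<theta>)))\<close>
  (\<open>shrinkage_loss_excess\<close>). It has to be shown that this has negative mean. Condition on the
  mixing variable \<open>V\<close>, and let \<open>h v\<close> be the mean of \<open>w\<close> for the normal law with variance
  \<open>v\<close> and centre \<open>\<theta>\<close>.

  Three facts carry the proof, \<open>d\<close> being the dimension. The conditional mean of
  \<open>w x * (x \<bullet> (x - \<theta>))\<close> is at least \<open>(d - 2) * v * h v\<close>, by Stein's method
  (\<open>stein_inequality\<close>). The product \<open>v * h v\<close> increases in \<open>v\<close>, because \<open>r\<close> increases
  and the centre moves towards the origin when the observation is standardised
  (\<open>scaled_weight_integral_mono\<close>). As \<open>1 / v\<close> decreases, Chebyshev's association inequality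
  then bounds the mean of \<open>h V\<close> by the product of the means of \<open>V * h V\<close> and \<open>1 / V\<close>
  (\<open>mean_weight_le\<close>). So \<open>a\<close> times the mean of \<open>1 / V\<close> being less than \<open>2 * (d - 2)\<close>
  makes the excess risk negative (\<open>shrinkage_risk_less\<close>).

  The bound on \<open>a\<close> provides this. The mean of \<open>1 / V\<close> is \<open>d - 2\<close> times the mean of
  \<open>1 / (norm x)\<^sup>2\<close> at the centre 0 (\<open>inverse_moment_origin\<close>), and the latter does not exceed
  the mean under the star law: \<open>deriv l\<close> decreases, so that the star law puts more weight on
  small norms (\<open>nn_integral_spherical_le_star\<close>).
\<close>

section \<open>Orthogonal invariance of Lebesgue measure\<close>

lemma nn_integral_lborel_translation:
  fixes f :: "'a::euclidean_space \<Rightarrow> ennreal"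
  assumes [measurable]: "f \<in> borel_measurable borel"
  shows "(\<integral>\<^sup>+x. f (c + x) \<partial>lborel) = (\<integral>\<^sup>+x. f x \<partial>lborel)"
  by (subst (2) lborel_distr_plus[of c, symmetric]) (simp add: nn_integral_distr)

lemma nn_integral_lborel_affine:
  fixes f :: "'a::euclidean_space \<Rightarrow> ennreal"
  assumes [measurable]: "f \<in> borel_measurable borel" and c: "c > 0"
  shows "(\<integral>\<^sup>+x. f x \<partial>lborel) = ennreal (c ^ DIM('a)) * (\<integral>\<^sup>+x. f (t + c *\<^sub>R x) \<partial>lborel)"
  using c by (subst lborel_affine[of c t])
    (simp_all add: nn_integral_density nn_integral_distr nn_integral_cmult)

text \<open>
  A translation-invariant measure is determined up to a factor, and the image of Lebesgue
  measure under \<open>T\<close> gives the unit ball the same finite positive mass. The proof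
  is the uniqueness argument by Fubini: the mass of \<open>g\<close>, the indicator of the ball, is moved
  from the factor \<open>g (T y)\<close> to the factor \<open>g (T y - x)\<close> by two translations.
\<close>

lemma nn_integral_lborel_orthogonal_transformation:
  fixes f :: "'a::euclidean_space \<Rightarrow> ennreal" and T :: "'a \<Rightarrow> 'a"
  assumes [measurable]: "f \<in> borel_measurable borel"
    and T: "orthogonal_transformation T"
  shows "(\<integral>\<^sup>+x. f (T x) \<partial>lborel) = (\<integral>\<^sup>+x. f x \<partial>lborel)"
proof -
  have lin: "linear T"
    using T by (rule orthogonal_transformation_linear)
  have [measurable]: "T \<in> borel_measurable borel"
    using lin by (intro borel_measurable_continuous_onI linear_continuous_on linear_linear[THEN iffD2])
  have norm_T: "norm (T x) = norm x" for x
    using T by (simp add: orthogonal_transformation_norm)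
  define g :: "'a \<Rightarrow> ennreal" where "g = indicator (ball 0 1)"
  have [measurable]: "g \<in> borel_measurable borel"
    unfolding g_def by (rule borel_measurable_indicator) simp
  define c where "c = (\<integral>\<^sup>+x. g x \<partial>lborel)"
  have "c = emeasure lborel (ball (0::'a) 1)"
    by (simp add: c_def g_def)
  then have c: "0 < c" "c < \<infinity>"
    using emeasure_lborel_ball_finite[of "0::'a" 1] by (simp_all add: emeasure_ball)
  have c_T: "(\<integral>\<^sup>+x. g (T x) \<partial>lborel) = c"
    by (simp add: c_def g_def indicator_def norm_T)
  have c_shift: "(\<integral>\<^sup>+x. g (z - x) \<partial>lborel) = c" for z
  proof -
    have "g (z - x) = g (- z + x)" for x
      by (simp add: g_def indicator_def norm_minus_commute)
    then show ?thesis
      using nn_integral_lborel_translation[of g "- z"] by (simp add: c_def)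
  qed
  have "(\<integral>\<^sup>+x. f x \<partial>lborel) * c = (\<integral>\<^sup>+y. \<integral>\<^sup>+x. f x * g (T y) \<partial>lborel \<partial>lborel)"
    by (simp add: nn_integral_cmult nn_integral_multc c_T)
  also have "\<dots> = (\<integral>\<^sup>+y. \<integral>\<^sup>+x. f (T y + x) * g (T y) \<partial>lborel \<partial>lborel)"
    by (simp add: nn_integral_multc nn_integral_lborel_translation)
  also have "\<dots> = (\<integral>\<^sup>+x. \<integral>\<^sup>+y. f (T y + x) * g (T y) \<partial>lborel \<partial>lborel)"
    by (rule lborel_pair.Fubini') measurable
  also have "\<dots> = (\<integral>\<^sup>+x. \<integral>\<^sup>+y. f (T y) * g (T y - x) \<partial>lborel \<partial>lborel)"
  proof (rule nn_integral_cong)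
    fix x :: 'a
    obtain w where "x = T w"
      using orthogonal_transformation_surj[OF T] by (meson surjD)
    then have "(\<integral>\<^sup>+y. f (T y + x) * g (T y) \<partial>lborel) = (\<integral>\<^sup>+y. f (T (w + y)) * g (T (w + y) - x) \<partial>lborel)"
      by (simp add: linear_add[OF lin] add.commute)
    then show "(\<integral>\<^sup>+y. f (T y + x) * g (T y) \<partial>lborel) = (\<integral>\<^sup>+y. f (T y) * g (T y - x) \<partial>lborel)"
      by (simp add: nn_integral_lborel_translation[of "\<lambda>y. f (T y) * g (T y - x)"])
  qed
  also have "\<dots> = (\<integral>\<^sup>+y. \<integral>\<^sup>+x. f (T y) * g (T y - x) \<partial>lborel \<partial>lborel)"
    by (rule lborel_pair.Fubini') measurable
  also have "\<dots> = (\<integral>\<^sup>+y. f (T y) \<partial>lborel) * c"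
    by (simp add: nn_integral_cmult nn_integral_multc c_shift)
  finally show ?thesis
    using c by (auto simp: ennreal_mult_cancel_left mult.commute[of _ c])
qed

section \<open>Association of monotone functions\<close>

text \<open>
  The products add up to more when larger is paired with larger. In \<open>ennreal\<close> this needs
  a form without subtraction.
\<close>

lemma ennreal_rearrangement:
  fixes a b c d :: ennreal
  assumes "a \<le> b" "c \<le> d"
  shows "a * d + b * c \<le> a * c + b * d"
proof -
  obtain e f where "b = a + e" "d = c + f"
    using assms by (auto simp: le_iff_add)
  then show ?thesis
    by (simp add: distrib_left distrib_right ac_simps add_increasing2)
qed

text \<open>
  Chebyshev's association inequality: when \<open>A\<close> and \<open>B\<close> are oppositely ordered,
  \<open>(A x - A y) * (B x - B y)\<close> is never positive; integrate over two independent copies of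
  the variable. The hypothesis is this sign condition with the subtractions cleared.
\<close>

lemma (in prob_space) nn_integral_chebyshev:
  fixes A B :: "'a \<Rightarrow> ennreal"
  assumes [measurable]: "A \<in> borel_measurable M" "B \<in> borel_measurable M"
    and S: "AE x in M. x \<in> S"
    and anti: "\<And>x y. x \<in> S \<Longrightarrow> y \<in> S \<Longrightarrow> A x * B x + A y * B y \<le> A x * B y + A y * B x"
  shows "(\<integral>\<^sup>+x. A x * B x \<partial>M) \<le> (\<integral>\<^sup>+x. A x \<partial>M) * (\<integral>\<^sup>+x. B x \<partial>M)"
proof -
  let ?I = "\<lambda>f. \<integral>\<^sup>+x. f x \<partial>M"
  have "2 * ?I (\<lambda>x. A x * B x) = (\<integral>\<^sup>+x. \<integral>\<^sup>+y. A x * B x + A y * B y \<partial>M \<partial>M)"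
    by (simp add: nn_integral_add emeasure_space_1 mult_2)
  also have "\<dots> \<le> (\<integral>\<^sup>+x. \<integral>\<^sup>+y. A x * B y + A y * B x \<partial>M \<partial>M)"
    by (intro nn_integral_mono_AE eventually_mono[OF S] anti)
  also have "\<dots> = 2 * (?I A * ?I B)"
    by (simp add: nn_integral_add nn_integral_cmult nn_integral_multc mult_2)
  finally show ?thesis
    by (simp add: ennreal_mult_le_mult_iff)
qed

section \<open>Isotropic Gaussian densities\<close>

definition gauss :: "'a::euclidean_space \<Rightarrow> real \<Rightarrow> 'a \<Rightarrow> real" where
  "gauss \<theta> v x = 1 / sqrt (2 * pi * v) ^ DIM('a) * exp (- (norm (x - \<theta>))\<^sup>2 / (2 * v))"

lemma gauss_pos: "0 < v \<Longrightarrow> 0 < gauss \<theta> v x"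
  by (simp add: gauss_def)

lemma measurable_gauss [measurable (raw)]:
  assumes [measurable]: "f \<in> borel_measurable M" "g \<in> borel_measurable M" "h \<in> borel_measurable M"
  shows "(\<lambda>w. gauss (f w) (g w) (h w)) \<in> borel_measurable M"
  unfolding gauss_def by measurable

lemma nn_integral_gauss_centred:
  fixes v :: real
  assumes v: "v > 0"
  shows "(\<integral>\<^sup>+x. ennreal (gauss (0::'a::euclidean_space) v x) \<partial>lborel) = 1"
proof -
  interpret product_sigma_finite "\<lambda>b::'a. lborel :: real measure"
    by standard
  let ?n = "\<lambda>t. ennreal (normal_density 0 (sqrt v) t)"
  have coord: "(\<integral>\<^sup>+t. ?n t \<partial>lborel) = 1"
    using prob_space.emeasure_space_1[OF prob_space_normal_density[of "sqrt v" 0]] v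
    by (simp add: emeasure_density)
  have "gauss 0 v (\<Sum>b\<in>Basis. y b *\<^sub>R b) = (\<Prod>b\<in>(Basis::'a set). normal_density 0 (sqrt v) (y b))" for y
  proof -
    have "(norm (\<Sum>b\<in>(Basis::'a set). y b *\<^sub>R b))\<^sup>2 = (\<Sum>b\<in>(Basis::'a set). (y b)\<^sup>2)"
      by (subst norm_sum_Pythagorean[OF finite_Basis])
         (auto simp: pairwise_def orthogonal_def inner_Basis intro!: sum.cong)
    then show ?thesis
      using v by (simp add: gauss_def normal_density_def exp_sum sum_negf sum_divide_distrib
          prod.distrib prod_dividef power_one_over flip: exp_sum)
  qed
  then have "ennreal (gauss 0 v (\<Sum>b\<in>Basis. y b *\<^sub>R b)) = (\<Prod>b\<in>(Basis::'a set). ?n (y b))" for y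
    by (simp add: prod_ennreal)
  then have "(\<integral>\<^sup>+x. ennreal (gauss (0::'a) v x) \<partial>lborel)
      = (\<integral>\<^sup>+y. (\<Prod>b\<in>(Basis::'a set). ?n (y b)) \<partial>(\<Pi>\<^sub>M b\<in>Basis. lborel))"
    by (subst lborel_eq) (simp add: nn_integral_distr)
  also have "\<dots> = 1"
    by (subst product_nn_integral_prod) (auto simp: coord)
  finally show ?thesis .
qed

lemma nn_integral_gauss:
  assumes v: "v > 0"
  shows "(\<integral>\<^sup>+x. ennreal (gauss (\<theta>::'a::euclidean_space) v x) \<partial>lborel) = 1"
proof -
  have "(\<integral>\<^sup>+x. ennreal (gauss \<theta> v x) \<partial>lborel) = (\<integral>\<^sup>+x. ennreal (gauss 0 v (- \<theta> + x)) \<partial>lborel)"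
    by (intro nn_integral_cong) (simp add: gauss_def)
  also have "\<dots> = (\<integral>\<^sup>+x. ennreal (gauss (0::'a) v x) \<partial>lborel)"
    by (rule nn_integral_lborel_translation) measurable
  also have "\<dots> = 1"
    using v by (rule nn_integral_gauss_centred)
  finally show ?thesis .
qed

text \<open>
  The factor \<open>exp (- s * (norm x)\<^sup>2)\<close> turns a Gaussian density of variance \<open>v\<close> into a
  multiple of the one of variance \<open>v / (1 + 2 * v * s)\<close>.
\<close>

lemma gauss_laplace:
  fixes v :: real
  assumes v: "v > 0" and s: "0 \<le> s"
  shows "(\<integral>\<^sup>+x. ennreal (exp (- s * (norm x)\<^sup>2)) * ennreal (gauss (0::'a::euclidean_space) v x) \<partial>lborel)
    = ennreal ((1 + 2 * v * s) powr (- real DIM('a) / 2))"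
proof -
  define c where "c = 1 + 2 * v * s"
  have c: "c > 0" using v s by (auto simp: c_def add_pos_nonneg)
  have sq: "c powr (- real DIM('a) / 2) = 1 / sqrt c ^ DIM('a)"
    using c by (simp add: powr_half_sqrt[symmetric] powr_powr powr_minus_divide flip: powr_realpow)
  have "exp (- s * (norm x)\<^sup>2) * gauss 0 v x = c powr (- real DIM('a) / 2) * gauss (0::'a) (v / c) x" for x
  proof -
    have "- s * (norm x)\<^sup>2 + - (norm x)\<^sup>2 / (2 * v) = - (norm x)\<^sup>2 / (2 * (v / c))"
      using v c by (simp add: field_simps) (simp add: c_def algebra_simps)
    then show ?thesis
      using v c unfolding gauss_def sq
      by (simp add: real_sqrt_divide power_divide real_sqrt_mult power_mult_distrib flip: exp_add)
  qed
  then have "ennreal (exp (- s * (norm x)\<^sup>2)) * ennreal (gauss 0 v x)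
      = ennreal (c powr (- real DIM('a) / 2)) * ennreal (gauss (0::'a) (v / c) x)" for x
    using gauss_pos[of v 0 x] gauss_pos[of "v/c" 0 x] v c
    by (simp flip: ennreal_mult)
  then show ?thesis
    using v c nn_integral_gauss[of "v / c" "0::'a"] by (simp add: nn_integral_cmult c_def)
qed

lemma nn_integral_exp_neg:
  fixes q :: real
  assumes "q > 0"
  shows "(\<integral>\<^sup>+s. ennreal (exp (- (s * q))) * indicator {0..} s \<partial>lborel) = ennreal (1 / q)"
proof -
  have "((\<lambda>s. - exp (- s * q) / q) \<longlongrightarrow> 0) at_top"
    using assms by real_asymp
  then have "(\<integral>\<^sup>+s. ennreal (exp (- (s * q))) * indicator {0..} s \<partial>lborel) = ennreal (0 - (- exp (- 0 * q) / q))"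
    using assms by (intro nn_integral_FTC_atLeast) (auto intro!: derivative_eq_intros)
  then show ?thesis by simp
qed

text \<open>
  Write \<open>1 / (norm x)\<^sup>2\<close> as the integral of \<open>exp (- s * (norm x)\<^sup>2)\<close> over
  \<open>s \<ge> 0\<close> and exchange the integrals. What remains is the integral of
  \<open>(1 + 2 * v * s) powr (- d / 2)\<close> over \<open>s \<ge> 0\<close>, which converges because the
  dimension \<open>d\<close> exceeds 2.
\<close>

lemma gauss_inverse_moment:
  fixes v :: real
  assumes dim: "DIM('a::euclidean_space) \<ge> 3" and v: "v > 0"
  shows "(\<integral>\<^sup>+x. ennreal (1 / (norm x)\<^sup>2) * ennreal (gauss (0::'a) v x) \<partial>lborel)
    = ennreal (1 / ((real DIM('a) - 2) * v))"
proof -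
  define p where "p = (real DIM('a) - 2) / 2"
  have p: "p > 0" using dim by (simp add: p_def)
  have "(\<integral>\<^sup>+x. ennreal (1 / (norm x)\<^sup>2) * ennreal (gauss (0::'a) v x) \<partial>lborel)
      = (\<integral>\<^sup>+x. (\<integral>\<^sup>+s. ennreal (exp (- s * (norm x)\<^sup>2)) * indicator {0..} s \<partial>lborel) * ennreal (gauss (0::'a) v x) \<partial>lborel)"
    by (intro nn_integral_cong_AE eventually_mono[OF AE_lborel_singleton[of "0::'a"]])
       (simp add: nn_integral_exp_neg)
  also have "\<dots> = (\<integral>\<^sup>+x. (\<integral>\<^sup>+s. ennreal (exp (- s * (norm x)\<^sup>2)) * indicator {0..} s * ennreal (gauss (0::'a) v x) \<partial>lborel) \<partial>lborel)"
    by (simp add: nn_integral_multc)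
  also have "\<dots> = (\<integral>\<^sup>+s. (\<integral>\<^sup>+x. ennreal (exp (- s * (norm x)\<^sup>2)) * indicator {0..} s * ennreal (gauss (0::'a) v x) \<partial>lborel) \<partial>lborel)"
    by (rule lborel_pair.Fubini') measurable
  also have "\<dots> = (\<integral>\<^sup>+s. ennreal ((1 + 2 * v * s) powr (- real DIM('a) / 2)) * indicator {0..} s \<partial>lborel)"
  proof (rule nn_integral_cong)
    fix s :: real
    have "(\<integral>\<^sup>+x. ennreal (exp (- s * (norm x)\<^sup>2)) * indicator {0..} s * ennreal (gauss (0::'a) v x) \<partial>lborel)
       = indicator {0..} s * (\<integral>\<^sup>+x. ennreal (exp (- s * (norm x)\<^sup>2)) * ennreal (gauss (0::'a) v x) \<partial>lborel)"
      by (subst nn_integral_cmult[symmetric]) (auto simp: ac_simps)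
    then show "(\<integral>\<^sup>+x. ennreal (exp (- s * (norm x)\<^sup>2)) * indicator {0..} s * ennreal (gauss (0::'a) v x) \<partial>lborel)
       = ennreal ((1 + 2 * v * s) powr (- real DIM('a) / 2)) * indicator {0..} s"
      using gauss_laplace[OF v, of s, where 'a='a] by (auto simp: indicator_def)
  qed
  also have "\<dots> = ennreal (0 - (-1 / (2 * v * p)) * (1 + 2 * v * 0) powr (- p))"
  proof (rule nn_integral_FTC_atLeast)
    show "((\<lambda>s. (-1 / (2 * v * p)) * (1 + 2 * v * s) powr (- p)) \<longlongrightarrow> 0) at_top"
      using v p by real_asymp
    show "((\<lambda>s. (-1 / (2 * v * p)) * (1 + 2 * v * s) powr (- p)) has_real_derivative
        (1 + 2 * v * s) powr (- real DIM('a) / 2)) (at s)" if "0 \<le> s" for s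
    proof -
      have "1 + 2 * v * s > 0" using v that by (auto simp: add_pos_nonneg)
      moreover have "- p - 1 = - real DIM('a) / 2" by (simp add: p_def field_simps)
      ultimately show ?thesis
        using v p by (auto intro!: derivative_eq_intros simp: mult.commute)
    qed
  qed auto
  also have "\<dots> = ennreal (1 / ((real DIM('a) - 2) * v))"
    using v dim by (simp add: p_def)
  finally show ?thesis .
qed

text \<open>
  A special case of Anderson's inequality, for integrands that decrease with the norm. Let \<open>m\<close> be
  the midpoint of the two centres, and \<open>T\<close> the reflection in the hyperplane orthogonal to
  \<open>\<mu>\<close>. In coordinates around \<open>m\<close>, \<open>T\<close> exchanges the two densities. Of two
  mirror points, the one on the side of the origin has the larger value of \<open>w\<close> and the
  larger density for the centre nearer to the origin, so that the two products satisfy the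
  rearrangement inequality.
\<close>

lemma nn_integral_gauss_shift_antimono:
  fixes w :: "'a::euclidean_space \<Rightarrow> ennreal"
  assumes [measurable]: "w \<in> borel_measurable borel"
    and w: "\<And>x y. norm x \<le> norm y \<Longrightarrow> w y \<le> w x"
    and st: "0 \<le> s" "s \<le> t" and v: "v > 0"
  shows "(\<integral>\<^sup>+x. w x * ennreal (gauss (t *\<^sub>R \<mu>) v x) \<partial>lborel) \<le> (\<integral>\<^sup>+x. w x * ennreal (gauss (s *\<^sub>R \<mu>) v x) \<partial>lborel)"
proof -
  define c where "c = (s + t) / 2"
  define m where "m = c *\<^sub>R \<mu>"
  define e where "e = (t - s) / 2"
  define p where "p z = ennreal (gauss 0 v z)" for z :: 'a
  have c: "0 \<le> c" and e: "0 \<le> e" using st by (auto simp: c_def e_def)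
  have [measurable]: "p \<in> borel_measurable borel"
    unfolding p_def by measurable
  have p_antimono: "p y \<le> p x" if "norm x \<le> norm y" for x y
  proof -
    have "(norm x)\<^sup>2 \<le> (norm y)\<^sup>2" using that by (simp add: power_mono)
    then have "gauss 0 v y \<le> gauss 0 v x"
      using v by (auto simp: gauss_def intro!: mult_left_mono divide_right_mono)
    then show ?thesis by (simp add: p_def ennreal_leI)
  qed
  \<comment> \<open>For \<open>\<mu> = 0\<close> the convention \<open>x / 0 = 0\<close> makes \<open>T\<close> the identity, and what follows still holds.\<close>
  define T where "T y = y - (2 * (y \<bullet> \<mu>) / (\<mu> \<bullet> \<mu>)) *\<^sub>R \<mu>" for y
  have T: "orthogonal_transformation T"
    unfolding orthogonal_transformation_def
  proof safe
    show "linear T"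
      by (rule linearI) (auto simp: T_def inner_add_left algebra_simps add_divide_distrib)
    show "T x \<bullet> T y = x \<bullet> y" for x y
      by (cases "\<mu> = 0") (auto simp: T_def inner_diff_left inner_diff_right field_simps inner_commute)
  qed
  have T_\<mu>: "T y \<bullet> \<mu> = - (y \<bullet> \<mu>)" for y
    by (cases "\<mu> = 0") (auto simp: T_def inner_diff_left)
  have norm_shift: "(norm (b *\<^sub>R \<mu> + y))\<^sup>2 = b\<^sup>2 * (\<mu> \<bullet> \<mu>) + (norm y)\<^sup>2 + 2 * b * (y \<bullet> \<mu>)" for b y
    unfolding power2_norm_eq_inner by (simp add: inner_add_left inner_add_right inner_commute power2_eq_square algebra_simps)
  have norm_T: "norm (T y) = norm y" for y
    using T by (rule orthogonal_transformation_norm)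
  have norm_T_shift: "norm (b *\<^sub>R \<mu> + T y) = norm (- b *\<^sub>R \<mu> + y)" for b y
    by (rule power2_eq_imp_eq) (simp_all only: norm_shift norm_T T_\<mu> norm_ge_zero, simp)
  have p_T: "p (b *\<^sub>R \<mu> + T y) = p (- b *\<^sub>R \<mu> + y)" for b y
    by (intro antisym p_antimono) (simp_all only: norm_T_shift order_refl)
  have [measurable]: "T \<in> borel_measurable borel"
    unfolding T_def by measurable
  define Q where "Q b = (\<integral>\<^sup>+y. w (m + y) * p (b *\<^sub>R \<mu> + y) \<partial>lborel)" for b
  have Q_T: "Q b = (\<integral>\<^sup>+y. w (m + T y) * p (- b *\<^sub>R \<mu> + y) \<partial>lborel)" for b
    unfolding Q_def p_T[symmetric]
    by (rule nn_integral_lborel_orthogonal_transformation[symmetric]) (use T in measurable)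
  \<comment> \<open>The offset \<open>e\<close> belongs to the centre \<open>s *\<^sub>R \<mu>\<close>, the offset \<open>- e\<close> to the centre \<open>t *\<^sub>R \<mu>\<close>.\<close>
  have pw: "w (m + y) * p (- e *\<^sub>R \<mu> + y) + w (m + T y) * p (e *\<^sub>R \<mu> + y)
      \<le> w (m + y) * p (e *\<^sub>R \<mu> + y) + w (m + T y) * p (- e *\<^sub>R \<mu> + y)" for y
  proof (cases "y \<bullet> \<mu> \<le> 0")
    case True
    have "(norm (m + y))\<^sup>2 \<le> (norm (m + T y))\<^sup>2" "(norm (e *\<^sub>R \<mu> + y))\<^sup>2 \<le> (norm (- e *\<^sub>R \<mu> + y))\<^sup>2"
      using True c e by (simp_all only: m_def norm_T_shift norm_shift)
        (simp_all add: mult_nonneg_nonpos)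
    then have "w (m + T y) \<le> w (m + y)" "p (- e *\<^sub>R \<mu> + y) \<le> p (e *\<^sub>R \<mu> + y)"
      by (auto intro!: w p_antimono dest: power2_le_imp_le)
    from ennreal_rearrangement[OF this] show ?thesis by (simp add: ac_simps)
  next
    case False
    have "(norm (m + T y))\<^sup>2 \<le> (norm (m + y))\<^sup>2" "(norm (- e *\<^sub>R \<mu> + y))\<^sup>2 \<le> (norm (e *\<^sub>R \<mu> + y))\<^sup>2"
      using False c e by (simp_all only: m_def norm_T_shift norm_shift) simp_all
    then have "w (m + y) \<le> w (m + T y)" "p (e *\<^sub>R \<mu> + y) \<le> p (- e *\<^sub>R \<mu> + y)"
      by (auto intro!: w p_antimono dest: power2_le_imp_le)
    from ennreal_rearrangement[OF this] show ?thesis by (simp add: ac_simps)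
  qed
  have "2 * Q (- e) = Q (- e) + Q (- e)"
    by (simp add: mult_2)
  also have "\<dots> = (\<integral>\<^sup>+y. w (m + y) * p (- e *\<^sub>R \<mu> + y) + w (m + T y) * p (e *\<^sub>R \<mu> + y) \<partial>lborel)"
    by (subst (2) Q_T) (simp add: Q_def nn_integral_add)
  also have "\<dots> \<le> (\<integral>\<^sup>+y. w (m + y) * p (e *\<^sub>R \<mu> + y) + w (m + T y) * p (- e *\<^sub>R \<mu> + y) \<partial>lborel)"
    by (intro nn_integral_mono pw)
  also have "\<dots> = Q e + Q e"
    by (subst (2) Q_T) (simp add: Q_def nn_integral_add)
  also have "\<dots> = 2 * Q e"
    by (simp add: mult_2)
  finally have "Q (- e) \<le> Q e"
    by (simp add: ennreal_mult_le_mult_iff)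
  moreover have "Q b = (\<integral>\<^sup>+x. w x * ennreal (gauss ((c - b) *\<^sub>R \<mu>) v x) \<partial>lborel)" for b
  proof -
    have "p (b *\<^sub>R \<mu> + y) = ennreal (gauss ((c - b) *\<^sub>R \<mu>) v (m + y))" for y
      by (simp add: p_def gauss_def m_def algebra_simps)
    then have "Q b = (\<integral>\<^sup>+y. w (m + y) * ennreal (gauss ((c - b) *\<^sub>R \<mu>) v (m + y)) \<partial>lborel)"
      by (simp add: Q_def)
    also have "\<dots> = (\<integral>\<^sup>+x. w x * ennreal (gauss ((c - b) *\<^sub>R \<mu>) v x) \<partial>lborel)"
      by (rule nn_integral_lborel_translation) measurable
    finally show ?thesis .
  qed
  moreover have "c - e = s" "c - (- e) = t" by (auto simp: c_def e_def field_simps)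
  ultimately show ?thesis by metis
qed

text \<open>
  Moving the centre away from the origin lowers the inverse moment, so the centred case gives
  a bound that is uniform in the centre.
\<close>

lemma gauss_inverse_moment_le:
  fixes \<theta> :: "'a::euclidean_space"
  assumes dim: "DIM('a) \<ge> 3" and v: "v > 0"
  shows "(\<integral>\<^sup>+x. ennreal (1 / (norm x)\<^sup>2) * ennreal (gauss \<theta> v x) \<partial>lborel)
    \<le> ennreal (1 / ((real DIM('a) - 2) * v))"
proof -
  \<comment> \<open>Since \<open>1 / 0 = 0\<close>, the inverse square norm decreases with the norm only after its value at \<open>0\<close> is changed.\<close>
  define w :: "'a \<Rightarrow> ennreal" where "w x = (if x = 0 then \<top> else ennreal (1 / (norm x)\<^sup>2))" for x
  have [measurable]: "w \<in> borel_measurable borel" unfolding w_def by measurable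
  have w: "w y \<le> w x" if "norm x \<le> norm y" for x y
    using that by (auto simp: w_def intro!: ennreal_leI divide_left_mono power_mono)
  have eq: "(\<integral>\<^sup>+x. ennreal (1 / (norm x)\<^sup>2) * ennreal (gauss \<eta> v x) \<partial>lborel) = (\<integral>\<^sup>+x. w x * ennreal (gauss \<eta> v x) \<partial>lborel)" for \<eta>
    by (intro nn_integral_cong_AE eventually_mono[OF AE_lborel_singleton[of "0::'a"]]) (simp add: w_def)
  have "(\<integral>\<^sup>+x. w x * ennreal (gauss \<theta> v x) \<partial>lborel) \<le> (\<integral>\<^sup>+x. w x * ennreal (gauss 0 v x) \<partial>lborel)"
    using nn_integral_gauss_shift_antimono[of w 0 1 v \<theta>] w v by simp
  also have "\<dots> = ennreal (1 / ((real DIM('a) - 2) * v))"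
    using gauss_inverse_moment[OF dim v] by (simp add: eq)
  finally show ?thesis by (simp add: eq)
qed

section \<open>Shrinkage weights under a Gaussian law\<close>

lemma integrable_times_density:
  fixes g :: "'a \<Rightarrow> real"
  assumes [measurable]: "g \<in> borel_measurable M" "p \<in> borel_measurable M" and "\<And>x. 0 \<le> p x"
    and "(\<integral>\<^sup>+x. ennreal \<bar>g x\<bar> * ennreal (p x) \<partial>M) < \<infinity>"
  shows "integrable M (\<lambda>x. g x * p x)"
  using assms by (intro integrableI_bounded) (simp_all add: abs_mult ennreal_mult)

text \<open>
  Monotonicity is required on the whole line, and not only on the positive half-line where
  squared norms lie, because it then gives measurability at once.
\<close>

locale shrinkage_profile =
  fixes \<rho> :: "real \<Rightarrow> real"
  assumes mono: "mono \<rho>"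
    and bounds: "0 \<le> \<rho> t" "\<rho> t \<le> 1"
    and ratio_antimono: "0 < s \<Longrightarrow> s \<le> t \<Longrightarrow> \<rho> t / t \<le> \<rho> s / s"
begin

lemma measurable_profile [measurable]: "\<rho> \<in> borel_measurable borel"
  using mono by (rule borel_measurable_mono)

definition weight :: "'a::euclidean_space \<Rightarrow> real" where
  "weight x = \<rho> ((norm x)\<^sup>2) / (norm x)\<^sup>2"

lemma measurable_weight [measurable]: "weight \<in> borel_measurable borel"
  unfolding weight_def by measurable

lemma weight_nonneg: "0 \<le> weight x"
  by (simp add: weight_def bounds)

lemma weight_le: "weight x \<le> 1 / (norm x)\<^sup>2"
  by (simp add: weight_def bounds divide_right_mono)

text \<open>
  With \<open>x = sqrt v *\<^sub>R z\<close> the scaled integral becomes the mean of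
  \<open>\<rho> (v * (norm z)\<^sup>2) / (norm z)\<^sup>2\<close> for \<open>z\<close> normal with unit variance and centre
  \<open>\<theta> / sqrt v\<close>. Raising \<open>v\<close> raises the integrand, as \<open>\<rho>\<close> increases, and brings
  the centre closer to the origin, which raises the mean because the integrand decreases with
  the norm of \<open>z\<close>.
\<close>

lemma scaled_weight_integral_mono:
  fixes \<theta> :: "'a::euclidean_space"
  assumes v: "0 < v" and vw: "v \<le> w"
  shows "ennreal v * (\<integral>\<^sup>+x. ennreal (weight x) * ennreal (gauss \<theta> v x) \<partial>lborel)
    \<le> ennreal w * (\<integral>\<^sup>+x. ennreal (weight x) * ennreal (gauss \<theta> w x) \<partial>lborel)"
proof -
  define \<Psi> where "\<Psi> u z = \<rho> (u * (norm z)\<^sup>2) / (norm z)\<^sup>2" for u and z :: 'a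
  have [measurable]: "(\<lambda>z. \<Psi> u z) \<in> borel_measurable borel" for u
    unfolding \<Psi>_def by measurable
  have standardise: "ennreal u * (\<integral>\<^sup>+x. ennreal (weight x) * ennreal (gauss \<theta> u x) \<partial>lborel)
      = (\<integral>\<^sup>+z. ennreal (\<Psi> u z) * ennreal (gauss ((1 / sqrt u) *\<^sub>R \<theta>) 1 z) \<partial>lborel)" if u: "u > 0" for u
  proof -
    let ?c = "sqrt u"
    have "?c ^ DIM('a) * gauss \<theta> u (?c *\<^sub>R z) = gauss ((1 / ?c) *\<^sub>R \<theta>) 1 z" for z
    proof -
      have "?c *\<^sub>R z - \<theta> = ?c *\<^sub>R (z - (1 / ?c) *\<^sub>R \<theta>)"
        using u by (simp add: scaleR_diff_right)
      then have "(norm (?c *\<^sub>R z - \<theta>))\<^sup>2 = u * (norm (z - (1 / ?c) *\<^sub>R \<theta>))\<^sup>2"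
        using u by (simp add: power_mult_distrib)
      then show ?thesis
        using u by (simp add: gauss_def real_sqrt_mult power_mult_distrib)
    qed
    moreover have "u * weight (?c *\<^sub>R z) = \<Psi> u z" for z :: 'a
      using u by (simp add: weight_def \<Psi>_def power_mult_distrib)
    ultimately have "u * ?c ^ DIM('a) * (weight (?c *\<^sub>R z) * gauss \<theta> u (?c *\<^sub>R z)) = \<Psi> u z * gauss ((1 / ?c) *\<^sub>R \<theta>) 1 z" for z
      by (metis mult.assoc mult.left_commute)
    then have *: "ennreal u * ennreal (?c ^ DIM('a)) * (ennreal (weight (?c *\<^sub>R z)) * ennreal (gauss \<theta> u (?c *\<^sub>R z)))
        = ennreal (\<Psi> u z) * ennreal (gauss ((1 / ?c) *\<^sub>R \<theta>) 1 z)" for z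
      using u gauss_pos[of u \<theta> "?c *\<^sub>R z"] gauss_pos[of 1 "(1 / ?c) *\<^sub>R \<theta>" z] weight_nonneg[of "?c *\<^sub>R z"]
      by (simp add: \<Psi>_def bounds less_imp_le flip: ennreal_mult)
    have "ennreal u * (\<integral>\<^sup>+x. ennreal (weight x) * ennreal (gauss \<theta> u x) \<partial>lborel)
        = ennreal u * ennreal (?c ^ DIM('a)) *
          (\<integral>\<^sup>+z. ennreal (weight (?c *\<^sub>R z)) * ennreal (gauss \<theta> u (?c *\<^sub>R z)) \<partial>lborel)"
      using u by (subst nn_integral_lborel_affine[where c = ?c and t = 0]) (simp_all add: mult.assoc)
    also have "\<dots> = (\<integral>\<^sup>+z. ennreal (\<Psi> u z) * ennreal (gauss ((1 / ?c) *\<^sub>R \<theta>) 1 z) \<partial>lborel)"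
      unfolding *[symmetric] by (rule nn_integral_cmult[symmetric]) measurable
    finally show ?thesis .
  qed
  define W where "W z = (if z = 0 then \<top> else ennreal (\<Psi> w z))" for z
  have [measurable]: "W \<in> borel_measurable borel"
    unfolding W_def by measurable
  have w: "0 < w" using v vw by simp
  have W_antimono: "W y \<le> W x" if "norm x \<le> norm y" for x y
  proof (cases "x = 0")
    case False
    then have x: "0 < w * (norm x)\<^sup>2" and y: "y \<noteq> 0" using w that by auto
    have xy: "w * (norm x)\<^sup>2 \<le> w * (norm y)\<^sup>2" using w that by (simp add: power_mono)
    have "w * (\<rho> (w * (norm y)\<^sup>2) / (w * (norm y)\<^sup>2)) \<le> w * (\<rho> (w * (norm x)\<^sup>2) / (w * (norm x)\<^sup>2))"
      using ratio_antimono[OF x xy] w by (intro mult_left_mono) auto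
    then show ?thesis
      using False y w by (simp add: W_def \<Psi>_def ennreal_leI)
  qed (simp add: W_def)
  have W_eq: "(\<integral>\<^sup>+z. ennreal (\<Psi> w z) * ennreal (gauss \<eta> 1 z) \<partial>lborel) = (\<integral>\<^sup>+z. W z * ennreal (gauss \<eta> 1 z) \<partial>lborel)" for \<eta>
    by (intro nn_integral_cong_AE eventually_mono[OF AE_lborel_singleton[of "0::'a"]]) (simp add: W_def)
  have "(\<integral>\<^sup>+z. ennreal (\<Psi> v z) * ennreal (gauss ((1 / sqrt v) *\<^sub>R \<theta>) 1 z) \<partial>lborel)
      \<le> (\<integral>\<^sup>+z. ennreal (\<Psi> w z) * ennreal (gauss ((1 / sqrt v) *\<^sub>R \<theta>) 1 z) \<partial>lborel)"
    using vw by (intro nn_integral_mono mult_right_mono ennreal_leI)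
      (auto simp: \<Psi>_def intro!: divide_right_mono monoD[OF mono] mult_right_mono)
  also have "\<dots> \<le> (\<integral>\<^sup>+z. ennreal (\<Psi> w z) * ennreal (gauss ((1 / sqrt w) *\<^sub>R \<theta>) 1 z) \<partial>lborel)"
    unfolding W_eq using v w vw
    by (intro nn_integral_gauss_shift_antimono W_antimono) (auto intro!: divide_left_mono)
  finally show ?thesis
    using v w by (simp add: standardise)
qed

text \<open>
  Through this bound the cross term of the loss is integrable as soon as the inverse square
  norm is. It combines \<open>weight x \<le> 1 / (norm x)\<^sup>2\<close> with \<open>1 / n \<le> 1 + 1 / n\<^sup>2\<close>.
\<close>

lemma weighted_inner_bound:
  "\<bar>weight x * (x \<bullet> (x - \<theta>))\<bar> \<le> 1 + norm \<theta> + norm \<theta> * (1 / (norm x)\<^sup>2)"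
  proof (cases "x = 0")
    case False
    define n where "n = norm x"
    have n: "n > 0" using False by (simp add: n_def)
    have "\<bar>x \<bullet> (x - \<theta>)\<bar> \<le> n * norm (x - \<theta>)"
      unfolding n_def by (rule Cauchy_Schwarz_ineq2)
    also have "\<dots> \<le> n * (n + norm \<theta>)"
      using n by (intro mult_left_mono) (auto simp: n_def intro: norm_triangle_ineq4)
    finally have "\<bar>weight x * (x \<bullet> (x - \<theta>))\<bar> \<le> weight x * (n * (n + norm \<theta>))"
      by (simp add: abs_mult weight_nonneg mult_left_mono)
    also have "\<dots> \<le> (1 / n\<^sup>2) * (n * (n + norm \<theta>))"
      using n weight_le[of x] by (intro mult_right_mono) (auto simp: n_def)
    also have "\<dots> = 1 + norm \<theta> * (1 / n)"
      using n by (simp add: field_simps power2_eq_square)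
    also have "1 / n \<le> 1 + 1 / n\<^sup>2"
    proof -
      have "0 \<le> (1 / n - 1 / 2)\<^sup>2" by simp
      then show ?thesis by (simp add: power2_eq_square algebra_simps)
    qed
    finally show ?thesis
      by (simp add: n_def mult_left_mono distrib_left)
  qed simp
text \<open>
  Stein's identity turns the integral of \<open>s\<close> into \<open>v\<close> times the integral of the divergence of
  \<open>weight x *\<^sub>R x\<close>, which is at least \<open>(d - 2) * weight x\<close>. Here the
  inequality comes from dilation, which replaces the derivative of \<open>\<rho>\<close> by its monotonicity. Let
  \<open>p\<close> be the Gaussian density. As \<open>\<rho>\<close> increases,
  \<open>t\<^sup>2 * weight (t *\<^sub>R x) \<ge> weight x\<close> for \<open>t > 1\<close>, so the substitution of
  \<open>t *\<^sub>R x\<close> for \<open>x\<close> shows that the integral of \<open>weight x * p x\<close> is at least that of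
  \<open>weight x * q x\<close>, where \<open>q x = t powr (d - 2) * p (t *\<^sub>R x)\<close>. Moreover
  \<open>q \<ge> p * (1 + u)\<close> where \<open>u\<close> is the logarithm of \<open>q / p\<close>, an explicit quadratic
  polynomial in \<open>x\<close>. Hence the integral of \<open>weight x * u x * p x\<close> is at most 0; dividing by
  \<open>t - 1\<close> and letting \<open>t\<close> tend to 1 gives the claim.
  
  The positive and negative parts of \<open>s\<close> stand on different sides, so that both sides are
  \<open>ennreal\<close> integrals and the inequality can be integrated over \<open>v\<close> as it stands.
\<close>

lemma stein_inequality:
  fixes \<theta> :: "'a::euclidean_space"
  assumes dim: "DIM('a) \<ge> 3" and v: "v > 0"
  defines "s \<equiv> \<lambda>x. weight x * (x \<bullet> (x - \<theta>))"
  shows "(\<integral>\<^sup>+x. ennreal (- s x) * ennreal (gauss \<theta> v x) \<partial>lborel)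
      + ennreal (real DIM('a) - 2) * (ennreal v * (\<integral>\<^sup>+x. ennreal (weight x) * ennreal (gauss \<theta> v x) \<partial>lborel))
    \<le> (\<integral>\<^sup>+x. ennreal (s x) * ennreal (gauss \<theta> v x) \<partial>lborel)"
proof -
  let ?p = "gauss \<theta> v"
  define d where "d = real DIM('a) - 2"
  have d: "d > 0" using dim by (simp add: d_def)
  have p_pos: "0 < ?p x" for x using v by (rule gauss_pos)
  have p_nonneg: "0 \<le> ?p x" for x using p_pos[of x] by simp
  have [measurable]: "s \<in> borel_measurable borel"
    unfolding s_def by measurable
  have int_p: "integrable lborel ?p"
    using nn_integral_gauss[OF v, of \<theta>] p_nonneg by (intro integrableI_nonneg) auto
  have int_inv: "integrable lborel (\<lambda>x. 1 / (norm x)\<^sup>2 * ?p x)"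
    using gauss_inverse_moment_le[OF dim v, of \<theta>] p_nonneg
    by (intro integrable_times_density) (auto intro: le_less_trans)
  have int_A: "integrable lborel (\<lambda>x. weight x * ?p x)"
    by (rule Bochner_Integration.integrable_bound[OF int_inv])
       (auto intro!: mult_right_mono simp: abs_mult p_nonneg weight_nonneg weight_le abs_of_nonneg simp del: times_divide_eq_left)
  have int_C: "integrable lborel (\<lambda>x. weight x * (norm x)\<^sup>2 * ?p x)"
    by (rule Bochner_Integration.integrable_bound[OF int_p])
       (auto intro!: mult_left_le_one_le simp: abs_mult p_nonneg weight_def bounds)
  have int_B: "integrable lborel (\<lambda>x. s x * ?p x)"
  proof (rule Bochner_Integration.integrable_bound)
    show "integrable lborel (\<lambda>x. (1 + norm \<theta>) * ?p x + norm \<theta> * (1 / (norm x)\<^sup>2 * ?p x))"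
      using int_p int_inv by (intro Bochner_Integration.integrable_add integrable_mult_right)
    show "AE x in lborel. norm (s x * ?p x) \<le> norm ((1 + norm \<theta>) * ?p x + norm \<theta> * (1 / (norm x)\<^sup>2 * ?p x))"
    proof (rule AE_I2)
      fix x :: 'a
      have "norm (s x * ?p x) \<le> (1 + norm \<theta> + norm \<theta> * (1 / (norm x)\<^sup>2)) * ?p x"
        using mult_right_mono[OF weighted_inner_bound[of x \<theta>] p_nonneg[of x]] p_nonneg[of x]
        by (simp add: s_def abs_mult)
      also have "\<dots> = (1 + norm \<theta>) * ?p x + norm \<theta> * (1 / (norm x)\<^sup>2 * ?p x)"
        by (simp add: algebra_simps)
      finally show "norm (s x * ?p x) \<le> norm ((1 + norm \<theta>) * ?p x + norm \<theta> * (1 / (norm x)\<^sup>2 * ?p x))"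
        by simp
    qed
  qed measurable
  define A where "A = (\<integral>x. weight x * ?p x \<partial>lborel)"
  define B where "B = (\<integral>x. s x * ?p x \<partial>lborel)"
  define C where "C = (\<integral>x. weight x * (norm x)\<^sup>2 * ?p x \<partial>lborel)"
  have nn_A: "(\<integral>\<^sup>+x. ennreal (weight x) * ennreal (?p x) \<partial>lborel) = ennreal A"
    using int_A unfolding A_def
    by (subst nn_integral_eq_integral[symmetric]) (simp_all add: weight_nonneg p_nonneg ennreal_mult)
  have A: "0 \<le> A" and C: "0 \<le> C"
    by (simp_all add: A_def C_def weight_nonneg p_nonneg)
  have key: "d * (1 - 1 / t) * A \<le> (t - 1) / v * B + (t - 1)\<^sup>2 / (2 * v) * C" if t: "t > 1" for t
  proof -
    define q where "q x = t powr d * ?p (t *\<^sub>R x)" for x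
    have q_nonneg: "0 \<le> q x" for x by (simp add: q_def p_nonneg)
    have [measurable]: "q \<in> borel_measurable borel" unfolding q_def by measurable
    have weight_t: "weight x \<le> t\<^sup>2 * weight (t *\<^sub>R x)" for x :: 'a
    proof -
      have "(norm x)\<^sup>2 \<le> t\<^sup>2 * (norm x)\<^sup>2" using t by (simp add: mult_le_cancel_right1)
      then have "\<rho> ((norm x)\<^sup>2) \<le> \<rho> (t\<^sup>2 * (norm x)\<^sup>2)" by (rule monoD[OF mono])
      then show ?thesis using t by (simp add: weight_def power_mult_distrib divide_right_mono)
    qed
    have t_pow: "t ^ DIM('a) = t powr d * t\<^sup>2"
    proof -
      have "real DIM('a) = d + 2" by (simp add: d_def)
      then have "t powr real DIM('a) = t powr d * t powr 2" by (simp add: powr_add)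
      then show ?thesis using t by (simp add: powr_realpow)
    qed
    have "(\<integral>\<^sup>+x. ennreal (weight x) * ennreal (q x) \<partial>lborel)
        \<le> (\<integral>\<^sup>+x. ennreal (t ^ DIM('a)) * (ennreal (weight (t *\<^sub>R x)) * ennreal (?p (t *\<^sub>R x))) \<partial>lborel)"
    proof (rule nn_integral_mono)
      fix x :: 'a
      have "weight x * q x \<le> t ^ DIM('a) * (weight (t *\<^sub>R x) * ?p (t *\<^sub>R x))"
        using mult_right_mono[OF weight_t[of x] q_nonneg[of x]] by (simp add: q_def t_pow algebra_simps)
      then show "ennreal (weight x) * ennreal (q x)
          \<le> ennreal (t ^ DIM('a)) * (ennreal (weight (t *\<^sub>R x)) * ennreal (?p (t *\<^sub>R x)))"
        using t by (simp add: q_nonneg weight_nonneg p_nonneg ennreal_leI flip: ennreal_mult)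
    qed
    also have "\<dots> = (\<integral>\<^sup>+x. ennreal (weight x) * ennreal (?p x) \<partial>lborel)"
      using t by (subst nn_integral_lborel_affine[where c = t and t = 0]) (simp_all add: nn_integral_cmult)
    finally have le: "(\<integral>\<^sup>+x. ennreal (weight x) * ennreal (q x) \<partial>lborel) \<le> ennreal A"
      by (simp add: nn_A)
    have int_q: "integrable lborel (\<lambda>x. weight x * q x)"
      using le by (intro integrable_times_density) (auto simp: q_nonneg weight_nonneg intro: le_less_trans)
    have "ennreal (\<integral>x. weight x * q x \<partial>lborel) \<le> ennreal A"
      using le int_q by (subst nn_integral_eq_integral[symmetric]) (simp_all add: q_nonneg weight_nonneg ennreal_mult)
    then have q_le: "(\<integral>x. weight x * q x \<partial>lborel) \<le> A"
      using A by (simp add: ennreal_le_iff)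
    \<comment> \<open>The expression in parentheses is the integral of \<open>weight x * u * p x\<close>.\<close>
    have "A + (d * ln t * A - (t - 1) / v * B - (t - 1)\<^sup>2 / (2 * v) * C)
        = (\<integral>x. weight x * ?p x + (d * ln t * (weight x * ?p x) - (t - 1) / v * (s x * ?p x)
            - (t - 1)\<^sup>2 / (2 * v) * (weight x * (norm x)\<^sup>2 * ?p x)) \<partial>lborel)"
      unfolding A_def B_def C_def using int_A int_B int_C
      by (simp del: times_divide_eq_left add: Bochner_Integration.integral_add Bochner_Integration.integral_diff)
    also have "\<dots> \<le> (\<integral>x. weight x * q x \<partial>lborel)"
    proof (rule integral_mono)
      fix x :: 'a
      define u where "u = d * ln t - (t - 1) / v * (x \<bullet> (x - \<theta>)) - (t - 1)\<^sup>2 / (2 * v) * (norm x)\<^sup>2"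
      have "(norm (t *\<^sub>R x - \<theta>))\<^sup>2 = (norm (x - \<theta>))\<^sup>2 + 2 * (t - 1) * (x \<bullet> (x - \<theta>)) + (t - 1)\<^sup>2 * (norm x)\<^sup>2"
        unfolding power2_norm_eq_inner
        by (simp add: inner_diff_left inner_diff_right inner_commute power2_eq_square algebra_simps)
      then have "d * ln t + - (norm (t *\<^sub>R x - \<theta>))\<^sup>2 / (2 * v) = u + - (norm (x - \<theta>))\<^sup>2 / (2 * v)"
        using v by (simp add: u_def add_divide_distrib diff_divide_distrib left_diff_distrib right_diff_distrib)
      then have "exp (d * ln t) * exp (- (norm (t *\<^sub>R x - \<theta>))\<^sup>2 / (2 * v)) = exp u * exp (- (norm (x - \<theta>))\<^sup>2 / (2 * v))"
        by (simp flip: exp_add)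
      then have "q x = exp u * ?p x"
        using t by (simp add: q_def powr_def gauss_def)
      then have "(1 + u) * ?p x \<le> q x"
        using exp_ge_add_one_self[of u] p_nonneg[of x] by (simp add: mult_right_mono)
      then have "weight x * ((1 + u) * ?p x) \<le> weight x * q x"
        by (intro mult_left_mono weight_nonneg)
      then show "weight x * ?p x + (d * ln t * (weight x * ?p x) - (t - 1) / v * (s x * ?p x)
            - (t - 1)\<^sup>2 / (2 * v) * (weight x * (norm x)\<^sup>2 * ?p x)) \<le> weight x * q x"
        by (simp add: u_def s_def algebra_simps)
    qed (use int_A int_B int_C int_q in \<open>simp_all del: times_divide_eq_left\<close>)
    finally have "d * ln t * A \<le> (t - 1) / v * B + (t - 1)\<^sup>2 / (2 * v) * C"
      using q_le by linarith
    moreover have "1 - 1 / t \<le> ln t"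
      using ln_le_minus_one[of "1 / t"] t by (simp add: ln_div)
    then have "d * (1 - 1 / t) * A \<le> d * ln t * A"
      using d A by (intro mult_right_mono mult_left_mono) auto
    ultimately show ?thesis by linarith
  qed
  have "d * A / t \<le> B / v + (t - 1) * (C / (2 * v))" if t: "t > 1" for t
  proof -
    have "(t - 1) * (d * A / t) \<le> (t - 1) * (B / v + (t - 1) * (C / (2 * v)))"
      using key[OF t] t by (simp add: field_simps power2_eq_square)
    then show ?thesis using t by (simp only: mult_le_cancel_left_pos)
  qed
  then have "eventually (\<lambda>t. d * A / t \<le> B / v + (t - 1) * (C / (2 * v))) (at_right 1)"
    by (auto simp: eventually_at_right_less eventually_at_filter)
  moreover have "((\<lambda>t. d * A / t) \<longlongrightarrow> d * A / 1) (at_right 1)"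
    by (intro tendsto_intros) auto
  moreover have "((\<lambda>t. B / v + (t - 1) * (C / (2 * v))) \<longlongrightarrow> B / v + (1 - 1) * (C / (2 * v))) (at_right 1)"
    by (intro tendsto_intros)
  ultimately have "d * A / 1 \<le> B / v + (1 - 1) * (C / (2 * v))"
    by (intro tendsto_le[OF trivial_limit_at_right_real]) 
  then have "d * (v * A) \<le> B"
    using v by (simp add: field_simps)
  have int_pos: "integrable lborel (\<lambda>x. max 0 (s x) * ?p x)"
    and int_neg: "integrable lborel (\<lambda>x. max 0 (- s x) * ?p x)"
    by (rule Bochner_Integration.integrable_bound[OF int_B];
        auto simp: abs_mult p_nonneg intro!: mult_right_mono)+
  have "B = (\<integral>x. max 0 (s x) * ?p x - max 0 (- s x) * ?p x \<partial>lborel)"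
    unfolding B_def by (intro Bochner_Integration.integral_cong) (auto simp: max_def)
  also have "\<dots> = (\<integral>x. max 0 (s x) * ?p x \<partial>lborel) - (\<integral>x. max 0 (- s x) * ?p x \<partial>lborel)"
    using int_pos int_neg by (rule Bochner_Integration.integral_diff)
  finally have "(\<integral>x. max 0 (- s x) * ?p x \<partial>lborel) + d * (v * A) \<le> (\<integral>x. max 0 (s x) * ?p x \<partial>lborel)"
    using \<open>d * (v * A) \<le> B\<close> by simp
  moreover have "(\<integral>\<^sup>+x. ennreal (s x) * ennreal (?p x) \<partial>lborel) = ennreal (\<integral>x. max 0 (s x) * ?p x \<partial>lborel)"
    using int_pos by (subst nn_integral_eq_integral[symmetric]) (simp_all add: p_nonneg ennreal_mult)
  moreover have "(\<integral>\<^sup>+x. ennreal (- s x) * ennreal (?p x) \<partial>lborel) = ennreal (\<integral>x. max 0 (- s x) * ?p x \<partial>lborel)"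
    using int_neg by (subst nn_integral_eq_integral[symmetric]) (simp_all add: p_nonneg ennreal_mult)
  ultimately show ?thesis
    using A v d by (simp add: nn_A p_nonneg ennreal_leI flip: d_def ennreal_mult ennreal_plus)
qed

end

section \<open>Scale mixtures of Gaussian laws\<close>

lemma normal_law_eq_density: "normal_law \<theta> v = density lborel (\<lambda>x. ennreal (gauss \<theta> v x))"
  by (simp add: normal_law_def gauss_def)

text \<open>
  The law of the observation for every centre \<open>\<theta>\<close>, with the mixing law \<open>G\<close> chosen
  once for all centres.
\<close>

locale scale_mixture = prob_space G
  for G :: "real measure" +
  fixes P :: "real ^ 'd \<Rightarrow> (real ^ 'd) measure"
  assumes sets_G [measurable_cong]: "sets G = sets borel"
    and positive: "AE v in G. 0 < v"
    and sets_P [measurable_cong]: "sets (P \<theta>) = sets borel"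
    and emeasure_P: "A \<in> sets borel \<Longrightarrow> emeasure (P \<theta>) A = (\<integral>\<^sup>+v. emeasure (normal_law \<theta> v) A \<partial>G)"
begin

text \<open>
  By Fubini the mixture has the density that averages the Gaussian densities over \<open>G\<close>.
\<close>

lemma nn_integral_mixture:
  assumes [measurable]: "F \<in> borel_measurable borel"
  shows "(\<integral>\<^sup>+x. F x \<partial>P \<theta>) = (\<integral>\<^sup>+v. \<integral>\<^sup>+x. F x * ennreal (gauss \<theta> v x) \<partial>lborel \<partial>G)"
proof -
  interpret pair_sigma_finite G "lborel :: (real ^ 'd) measure" ..
  define h where "h x = (\<integral>\<^sup>+v. ennreal (gauss \<theta> v x) \<partial>G)" for x :: "real ^ 'd"
  have [measurable]: "h \<in> borel_measurable borel"
    unfolding h_def by measurable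
  have swap: "(\<integral>\<^sup>+x. h x * H x \<partial>lborel) = (\<integral>\<^sup>+v. \<integral>\<^sup>+x. H x * ennreal (gauss \<theta> v x) \<partial>lborel \<partial>G)"
    if [measurable]: "H \<in> borel_measurable borel" for H :: "real ^ 'd \<Rightarrow> ennreal"
  proof -
    have "(\<integral>\<^sup>+x. h x * H x \<partial>lborel) = (\<integral>\<^sup>+x. \<integral>\<^sup>+v. H x * ennreal (gauss \<theta> v x) \<partial>G \<partial>lborel)"
      by (simp add: h_def nn_integral_cmult mult.commute)
    also have "\<dots> = (\<integral>\<^sup>+v. \<integral>\<^sup>+x. H x * ennreal (gauss \<theta> v x) \<partial>lborel \<partial>G)"
      by (rule Fubini') measurable
    finally show ?thesis .
  qed
  have "P \<theta> = density lborel h"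
  proof (rule measure_eqI)
    fix A assume "A \<in> sets (P \<theta>)"
    then have [measurable]: "A \<in> sets borel" by (simp add: sets_P)
    show "emeasure (P \<theta>) A = emeasure (density lborel h) A"
      by (simp add: emeasure_P emeasure_density swap normal_law_eq_density mult.commute)
  qed (simp add: sets_P)
  then show ?thesis
    by (simp add: nn_integral_density swap)
qed

lemma emeasure_space_P: "emeasure (P \<theta>) (space (P \<theta>)) = 1"
proof -
  have "(\<integral>\<^sup>+x. 1 \<partial>P \<theta>) = (\<integral>\<^sup>+v. \<integral>\<^sup>+x. 1 * ennreal (gauss \<theta> v x) \<partial>lborel \<partial>G)"
    by (rule nn_integral_mixture) simp
  also have "\<dots> = (\<integral>\<^sup>+v. 1 \<partial>G)"
    by (intro nn_integral_cong_AE eventually_mono[OF positive]) (simp add: nn_integral_gauss)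
  finally show ?thesis by (simp add: emeasure_space_1)
qed

definition mean_precision :: ennreal where
  "mean_precision = (\<integral>\<^sup>+v. ennreal (1 / v) \<partial>G)"

lemma inverse_moment_le:
  assumes dim: "CARD('d) \<ge> 3"
  shows "(\<integral>\<^sup>+x. ennreal (1 / (norm x)\<^sup>2) \<partial>P \<theta>) \<le> ennreal (1 / (real CARD('d) - 2)) * mean_precision"
proof -
  have "(\<integral>\<^sup>+x. ennreal (1 / (norm x)\<^sup>2) \<partial>P \<theta>) \<le> (\<integral>\<^sup>+v. ennreal (1 / (real CARD('d) - 2)) * ennreal (1 / v) \<partial>G)"
    using dim
    by (subst nn_integral_mixture)
       (auto intro!: nn_integral_mono_AE eventually_mono[OF positive] order_trans[OF gauss_inverse_moment_le]
          simp flip: ennreal_mult)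
  then show ?thesis
    by (simp add: mean_precision_def nn_integral_cmult)
qed

lemma inverse_moment_origin:
  assumes dim: "CARD('d) \<ge> 3"
  shows "(\<integral>\<^sup>+x. ennreal (1 / (norm x)\<^sup>2) \<partial>P 0) = ennreal (1 / (real CARD('d) - 2)) * mean_precision"
proof -
  have "(\<integral>\<^sup>+x. ennreal (1 / (norm x)\<^sup>2) \<partial>P 0) = (\<integral>\<^sup>+v. ennreal (1 / (real CARD('d) - 2)) * ennreal (1 / v) \<partial>G)"
    using dim
    by (subst nn_integral_mixture)
       (auto intro!: nn_integral_cong_AE eventually_mono[OF positive]
          simp: gauss_inverse_moment simp flip: ennreal_mult)
  then show ?thesis
    by (simp add: mean_precision_def nn_integral_cmult)
qed

end

section \<open>Risk comparison under a scale mixture\<close>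

text \<open>
  A profile that vanishes identically has to be excluded, since it reproduces the observation
  and leaves the risk unchanged.
\<close>

locale shrinkage_problem = scale_mixture G P + shrinkage_profile \<rho>
  for G and P :: "real ^ 'd \<Rightarrow> (real ^ 'd) measure" and \<rho> +
  assumes dim: "CARD('d) \<ge> 3"
    and nontrivial: "\<exists>t. \<rho> t \<noteq> 0"
begin

definition gauss_weight :: "real ^ 'd \<Rightarrow> real \<Rightarrow> ennreal" where
  "gauss_weight \<theta> v = (\<integral>\<^sup>+x. ennreal (weight x) * ennreal (gauss \<theta> v x) \<partial>lborel)"

lemma measurable_gauss_weight [measurable]: "gauss_weight \<theta> \<in> borel_measurable borel"
  unfolding gauss_weight_def by measurable

definition mean_weight :: "real ^ 'd \<Rightarrow> ennreal" where
  "mean_weight \<theta> = (\<integral>\<^sup>+v. gauss_weight \<theta> v \<partial>G)"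

definition mean_scaled_weight :: "real ^ 'd \<Rightarrow> ennreal" where
  "mean_scaled_weight \<theta> = (\<integral>\<^sup>+v. ennreal v * gauss_weight \<theta> v \<partial>G)"

lemma mean_weight_eq: "mean_weight \<theta> = (\<integral>\<^sup>+x. ennreal (weight x) \<partial>P \<theta>)"
  by (subst nn_integral_mixture) (simp_all add: mean_weight_def gauss_weight_def)

text \<open>
  The Gaussian mean of the weight is the product of its multiple by \<open>v\<close>, which increases in
  \<open>v\<close>, and of \<open>1 / v\<close>, which decreases.
\<close>

lemma mean_weight_le: "mean_weight \<theta> \<le> mean_scaled_weight \<theta> * mean_precision"
proof -
  have "mean_weight \<theta> = (\<integral>\<^sup>+v. (ennreal v * gauss_weight \<theta> v) * ennreal (1 / v) \<partial>G)"
    unfolding mean_weight_def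
  proof (intro nn_integral_cong_AE eventually_mono[OF positive])
    fix v :: real
    assume v: "0 < v"
    then have "ennreal v * ennreal (1 / v) = 1"
      by (simp flip: ennreal_mult)
    then show "gauss_weight \<theta> v = (ennreal v * gauss_weight \<theta> v) * ennreal (1 / v)"
      by (simp add: mult.commute mult.left_commute flip: mult.assoc)
  qed
  also have "\<dots> \<le> mean_scaled_weight \<theta> * mean_precision"
    unfolding mean_scaled_weight_def mean_precision_def
  proof (rule nn_integral_chebyshev[where S = "{0<..}"])
    fix v w :: real
    assume "v \<in> {0<..}" "w \<in> {0<..}"
    then have vw: "0 < v" "0 < w" by auto
    let ?A = "\<lambda>v. ennreal v * gauss_weight \<theta> v" and ?B = "\<lambda>v. ennreal (1 / v)"
    have mono: "?A s * ?B s + ?A t * ?B t \<le> ?A s * ?B t + ?A t * ?B s" if "0 < s" "s \<le> t" for s t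
    proof -
      have "?A s \<le> ?A t"
        unfolding gauss_weight_def using that by (rule scaled_weight_integral_mono)
      moreover have "?B t \<le> ?B s"
        using that by (intro ennreal_leI divide_left_mono) auto
      ultimately show ?thesis by (rule ennreal_rearrangement)
    qed
    show "?A v * ?B v + ?A w * ?B w \<le> ?A v * ?B w + ?A w * ?B v"
      using mono[of v w] mono[of w v] vw by (cases "v \<le> w") (simp_all add: add.commute)
  qed (use positive in auto)
  finally show ?thesis .
qed

lemma not_AE_weight_zero: "\<not> (AE x in (lborel :: (real ^ 'd) measure). weight x = 0)"
proof
  assume AE: "AE x in (lborel :: (real ^ 'd) measure). weight x = 0"
  obtain t0 where t0: "\<rho> t0 \<noteq> 0" using nontrivial by auto
  define t where "t = max 1 t0"
  have t: "0 < t" "0 < \<rho> t"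
    using t0 bounds(1)[of t0] monoD[OF mono, of t0 t] by (auto simp: t_def)
  have "AE x in (lborel :: (real ^ 'd) measure). x \<in> UNIV \<longleftrightarrow> x \<in> ball 0 (sqrt t)"
    using AE
  proof (rule eventually_mono)
    fix x :: "real ^ 'd"
    assume w: "weight x = 0"
    have "\<not> t \<le> (norm x)\<^sup>2"
    proof
      assume *: "t \<le> (norm x)\<^sup>2"
      then have "0 < \<rho> ((norm x)\<^sup>2)"
        using t monoD[OF mono *] by linarith
      with * t w show False by (auto simp: weight_def)
    qed
    then show "x \<in> UNIV \<longleftrightarrow> x \<in> ball 0 (sqrt t)"
      by (simp add: real_less_rsqrt)
  qed
  then have "emeasure lborel (UNIV :: (real ^ 'd) set) = emeasure lborel (ball (0 :: real ^ 'd) (sqrt t))"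
    by (rule emeasure_eq_AE) auto
  then show False
    using emeasure_lborel_ball_finite[of "0 :: real ^ 'd" "sqrt t"] by simp
qed

text \<open>
  A Gaussian law gives positive mass to the set where the weight is positive, which contains
  the complement of a ball.
\<close>

lemma mean_weight_pos: "0 < mean_weight \<theta>"
proof (rule ccontr)
  assume "\<not> 0 < mean_weight \<theta>"
  then have "(\<integral>\<^sup>+v. gauss_weight \<theta> v \<partial>G) = 0" by (simp add: mean_weight_def)
  then have "AE v in G. gauss_weight \<theta> v = 0"
    by (subst (asm) nn_integral_0_iff_AE) auto
  then have "AE v in G. 0 < v \<and> gauss_weight \<theta> v = 0"
    using positive by auto
  then obtain v where v: "0 < v" "gauss_weight \<theta> v = 0"
    using eventually_happens'[OF ae_filter_bot] by blast
  then have "AE x in lborel. ennreal (weight x) * ennreal (gauss \<theta> v x) = 0"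
    unfolding gauss_weight_def by (subst (asm) nn_integral_0_iff_AE) auto
  then have "AE x in (lborel :: (real ^ 'd) measure). weight x = 0"
  proof (rule eventually_mono)
    fix x :: "real ^ 'd"
    assume "ennreal (weight x) * ennreal (gauss \<theta> v x) = 0"
    then show "weight x = 0"
      using gauss_pos[OF v(1), of \<theta> x] weight_nonneg[of x] by (auto simp: ennreal_eq_0_iff)
  qed
  then show False using not_AE_weight_zero by simp
qed

text \<open>
  The signed part of the excess loss, linear in the amount of shrinkage.
\<close>

definition cross :: "real ^ 'd \<Rightarrow> real ^ 'd \<Rightarrow> real" where
  "cross \<theta> x = weight x * (x \<bullet> (x - \<theta>))"

lemma measurable_cross [measurable]: "cross \<theta> \<in> borel_measurable borel"
  unfolding cross_def by measurable

lemma mixture_stein_inequality: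
  "(\<integral>\<^sup>+x. ennreal (- cross \<theta> x) \<partial>P \<theta>) + ennreal (real CARD('d) - 2) * mean_scaled_weight \<theta>
    \<le> (\<integral>\<^sup>+x. ennreal (cross \<theta> x) \<partial>P \<theta>)"
proof -
  have "(\<integral>\<^sup>+x. ennreal (- cross \<theta> x) \<partial>P \<theta>) + ennreal (real CARD('d) - 2) * mean_scaled_weight \<theta>
      = (\<integral>\<^sup>+v. (\<integral>\<^sup>+x. ennreal (- cross \<theta> x) * ennreal (gauss \<theta> v x) \<partial>lborel)
          + ennreal (real CARD('d) - 2) * (ennreal v * gauss_weight \<theta> v) \<partial>G)"
    by (subst nn_integral_mixture) (simp_all add: mean_scaled_weight_def nn_integral_add nn_integral_cmult)
  also have "\<dots> \<le> (\<integral>\<^sup>+v. \<integral>\<^sup>+x. ennreal (cross \<theta> x) * ennreal (gauss \<theta> v x) \<partial>lborel \<partial>G)"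
    using stein_inequality[where 'a = "real ^ 'd"] dim
    by (intro nn_integral_mono_AE eventually_mono[OF positive]) (simp add: cross_def gauss_weight_def)
  also have "\<dots> = (\<integral>\<^sup>+x. ennreal (cross \<theta> x) \<partial>P \<theta>)"
    by (subst nn_integral_mixture) simp_all
  finally show ?thesis .
qed

lemma cross_finite:
  assumes "mean_precision < \<infinity>"
  shows "(\<integral>\<^sup>+x. ennreal \<bar>cross \<theta> x\<bar> \<partial>P \<theta>) < \<infinity>"
proof -
  have "(\<integral>\<^sup>+x. ennreal \<bar>cross \<theta> x\<bar> \<partial>P \<theta>)
      \<le> (\<integral>\<^sup>+x. ennreal (1 + norm \<theta>) * 1 + ennreal (norm \<theta>) * ennreal (1 / (norm x)\<^sup>2) \<partial>P \<theta>)"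
    using weighted_inner_bound[of _ \<theta>]
    by (intro nn_integral_mono) (auto simp: cross_def intro!: ennreal_leI simp flip: ennreal_mult ennreal_plus)
  also have "\<dots> = ennreal (1 + norm \<theta>) * (\<integral>\<^sup>+x. 1 \<partial>P \<theta>) + ennreal (norm \<theta>) * (\<integral>\<^sup>+x. ennreal (1 / (norm x)\<^sup>2) \<partial>P \<theta>)"
    by (subst nn_integral_add) (simp_all add: nn_integral_cmult)
  also have "\<dots> < \<infinity>"
    using inverse_moment_le[OF dim, of \<theta>] assms
    by (auto simp: emeasure_space_P ennreal_mult_less_top intro: le_less_trans)
  finally show ?thesis .
qed

text \<open>
  Write \<open>H\<close> for the mean weight and \<open>K\<close> for the mean of the weight scaled by the
  variance. The mean excess loss is at most \<open>c * a\<close> times \<open>a * H\<close> minus twice the mean of the cross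
  term. Stein's inequality bounds that mean below by \<open>(d - 2) * K\<close>, and
  \<open>H \<le> K * mean_precision\<close>; so the excess is negative when
  \<open>a * mean_precision < 2 * (d - 2)\<close>. Positivity and finiteness of \<open>K\<close> make the
  inequality strict.
\<close>

lemma shrinkage_risk_less:
  fixes a c :: real
  assumes a: "0 < a" and c: "0 < c"
    and precision: "ennreal a * mean_precision < ennreal (2 * (real CARD('d) - 2))"
    and [measurable]: "L\<^sub>0 \<in> borel_measurable borel" "L\<^sub>1 \<in> borel_measurable borel"
    and nonneg: "\<And>x. 0 \<le> L\<^sub>0 x" "\<And>x. 0 \<le> L\<^sub>1 x"
    and excess: "\<And>x. L\<^sub>1 x \<le> L\<^sub>0 x + c * (a\<^sup>2 * weight x - 2 * a * cross \<theta> x)"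
    and finite: "(\<integral>\<^sup>+x. ennreal (L\<^sub>0 x) \<partial>P \<theta>) < \<infinity>"
  shows "(\<integral>\<^sup>+x. ennreal (L\<^sub>1 x) \<partial>P \<theta>) < (\<integral>\<^sup>+x. ennreal (L\<^sub>0 x) \<partial>P \<theta>)"
proof -
  define d where "d = real CARD('d) - 2"
  have d: "0 < d" using dim by (simp add: d_def)
  let ?I = "\<lambda>g. \<integral>\<^sup>+x. ennreal (g x) \<partial>P \<theta>"
  define S where "S = ?I (cross \<theta>)"
  define S' where "S' = ?I (\<lambda>x. - cross \<theta> x)"
  let ?H = "mean_weight \<theta>" and ?K = "mean_scaled_weight \<theta>"
  have I: "mean_precision < \<infinity>"
    using precision a by (metis ennreal_less_top ennreal_mult_eq_top_iff ennreal_eq_0_iff infinity_ennreal_def less_top not_le order_less_trans)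
  have "S \<le> ?I (\<lambda>x. \<bar>cross \<theta> x\<bar>)" "S' \<le> ?I (\<lambda>x. \<bar>cross \<theta> x\<bar>)"
    unfolding S_def S'_def by (auto intro!: nn_integral_mono ennreal_leI)
  then have S_fin: "S < \<infinity>" "S' < \<infinity>"
    using cross_finite[OF I, of \<theta>] by (auto intro: le_less_trans)
  have stein: "S' + ennreal d * ?K \<le> S"
    using mixture_stein_inequality by (simp add: S_def S'_def d_def)
  have "ennreal d * ?K < \<infinity>"
    using stein S_fin by (meson add_increasing le_less_trans order_refl zero_le)
  then have K_fin: "?K < \<infinity>"
    using d by (auto simp: ennreal_mult_less_top)
  have K_pos: "0 < ?K"
    using mean_weight_pos[of \<theta>] mean_weight_le[of \<theta>] by (auto intro!: gr_zeroI)
  \<comment> \<open>The negative part of the cross term is moved to the other side, so that every term is nonnegative.\<close>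
  have "?I L\<^sub>1 + ennreal (2 * a * c) * S
      = (\<integral>\<^sup>+x. ennreal (L\<^sub>1 x) + ennreal (2 * a * c) * ennreal (cross \<theta> x) \<partial>P \<theta>)"
    by (simp add: S_def nn_integral_add nn_integral_cmult)
  also have "\<dots> \<le> (\<integral>\<^sup>+x. ennreal (L\<^sub>0 x) + ennreal (c * a\<^sup>2) * ennreal (weight x)
      + ennreal (2 * a * c) * ennreal (- cross \<theta> x) \<partial>P \<theta>)"
  proof (rule nn_integral_mono)
    fix x
    have "max 0 (cross \<theta> x) = cross \<theta> x + max 0 (- cross \<theta> x)" by (simp add: max_def)
    then have "L\<^sub>1 x + 2 * a * c * max 0 (cross \<theta> x) \<le> L\<^sub>0 x + c * a\<^sup>2 * weight x + 2 * a * c * max 0 (- cross \<theta> x)"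
      using excess[of x] by (simp add: algebra_simps)
    then have "ennreal (L\<^sub>1 x + 2 * a * c * max 0 (cross \<theta> x)) \<le> ennreal (L\<^sub>0 x + c * a\<^sup>2 * weight x + 2 * a * c * max 0 (- cross \<theta> x))"
      by (rule ennreal_leI)
    then show "ennreal (L\<^sub>1 x) + ennreal (2 * a * c) * ennreal (cross \<theta> x)
      \<le> ennreal (L\<^sub>0 x) + ennreal (c * a\<^sup>2) * ennreal (weight x) + ennreal (2 * a * c) * ennreal (- cross \<theta> x)"
      using a c nonneg[of x] weight_nonneg[of x] by (simp add: ennreal_plus ennreal_mult)
  qed
  also have "\<dots> = ?I L\<^sub>0 + ennreal (c * a\<^sup>2) * ?H + ennreal (2 * a * c) * S'"
    by (simp add: S'_def mean_weight_eq nn_integral_add nn_integral_cmult)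
  also have "\<dots> \<le> ?I L\<^sub>0 + ennreal (c * a\<^sup>2) * (?K * mean_precision) + ennreal (2 * a * c) * S'"
    by (intro add_mono mult_left_mono mean_weight_le) auto
  finally have le: "?I L\<^sub>1 + ennreal (2 * a * c) * (S' + ennreal d * ?K)
      \<le> ?I L\<^sub>0 + ennreal (c * a\<^sup>2) * (?K * mean_precision) + ennreal (2 * a * c) * S'"
    using stein by (meson add_left_mono mult_left_mono order_trans zero_le)
  obtain k where k: "?K = ennreal k" "0 < k"
    using K_fin K_pos by (cases ?K) auto
  obtain i where i: "mean_precision = ennreal i" "0 \<le> i"
    using I by (cases mean_precision) auto
  obtain s where s: "S' = ennreal s" "0 \<le> s"
    using S_fin by (cases S') auto
  obtain l where l: "?I L\<^sub>0 = ennreal l" "0 \<le> l"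
    using finite by (cases "?I L\<^sub>0") auto
  have ai: "a * i < 2 * d"
    using precision a i d by (simp add: d_def[symmetric] ennreal_less_iff flip: ennreal_mult)
  have le': "?I L\<^sub>1 + ennreal (2 * a * c * (s + d * k)) \<le> ennreal (l + c * a\<^sup>2 * (k * i) + 2 * a * c * s)"
    using le a c d k i s l by (simp add: ennreal_plus[symmetric] ennreal_mult[symmetric] del: ennreal_plus)
  then have "?I L\<^sub>1 < \<infinity>"
    by (metis add_increasing2 ennreal_less_top infinity_ennreal_def le_less_trans order_refl zero_le)
  then obtain m where m: "?I L\<^sub>1 = ennreal m" "0 \<le> m"
    by (cases "?I L\<^sub>1") auto
  have "m + 2 * a * c * (s + d * k) \<le> l + c * a\<^sup>2 * (k * i) + 2 * a * c * s"
    using le' a c d k i s l m by (simp add: ennreal_plus[symmetric] ennreal_le_iff del: ennreal_plus)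
  moreover have "c * a * k * (a * i) < c * a * k * (2 * d)"
    using a c k ai by (intro mult_strict_left_mono) auto
  ultimately have "m < l"
    by (simp add: power2_eq_square algebra_simps)
  then show ?thesis
    using l m by (simp add: ennreal_less_iff)
qed

end

section \<open>Reweighting by a decreasing function, and the balanced loss\<close>

text \<open>
  With respect to the spherical law centred at 0, the star law has density
  \<open>deriv l ((1 - \<omega>) * (norm x)\<^sup>2) / K1\<close>, which decreases with the norm. Conversely the spherical law has the
  reciprocal, an increasing function of mean 1, as its density with respect to the star law; a
  decreasing function is negatively associated with it, so its mean is smaller under the
  spherical law.
\<close>

lemma nn_integral_spherical_le_star:
  fixes f l :: "real \<Rightarrow> real" and w :: "real ^ 'd \<Rightarrow> real"
  assumes f [measurable]: "(\<lambda>x :: real ^ 'd. f ((norm x)\<^sup>2)) \<in> borel_measurable borel"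
    and f_nonneg: "\<And>t. 0 \<le> t \<Longrightarrow> 0 \<le> f t"
    and mass: "emeasure (spherical_law f (0 :: real ^ 'd)) UNIV = 1"
    and omega: "\<omega> < 1"
    and D [measurable]: "(\<lambda>x :: real ^ 'd. deriv l ((1 - \<omega>) * (norm x)\<^sup>2)) \<in> borel_measurable borel"
    and D_pos: "\<And>t. 0 < t \<Longrightarrow> 0 < deriv l t"
    and D_antimono: "\<And>s t. 0 < s \<Longrightarrow> s \<le> t \<Longrightarrow> deriv l t \<le> deriv l s"
    and star: "prob_space (star_law f l \<omega> :: (real ^ 'd) measure)"
    and w [measurable]: "w \<in> borel_measurable borel"
    and w_antimono: "\<And>x y. x \<noteq> 0 \<Longrightarrow> norm x \<le> norm y \<Longrightarrow> w y \<le> w x"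
  shows "(\<integral>\<^sup>+x. ennreal (w x) \<partial>spherical_law f 0) \<le> (\<integral>\<^sup>+x. ennreal (w x) \<partial>star_law f l \<omega>)"
proof -
  define D where "D x = deriv l ((1 - \<omega>) * (norm x)\<^sup>2)" for x :: "real ^ 'd"
  define k where "k = K1 f l \<omega> TYPE('d)"
  define F where "F x = f ((norm x)\<^sup>2)" for x :: "real ^ 'd"
  have [measurable]: "D \<in> borel_measurable borel" "F \<in> borel_measurable borel"
    unfolding D_def F_def by measurable
  have F_nonneg: "0 \<le> F x" for x by (simp add: F_def f_nonneg)
  have D_pos': "0 < D x" if "x \<noteq> 0" for x
    using that omega by (auto simp: D_def intro!: D_pos)
  have D_antimono': "D y \<le> D x" if "x \<noteq> 0" "norm x \<le> norm y" for x y
    using that omega by (auto simp: D_def intro!: D_antimono mult_left_mono power_mono)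
  have star_eq: "star_law f l \<omega> = density lborel (\<lambda>x :: real ^ 'd. ennreal (D x * F x / k))"
    by (simp add: star_law_def f_star_def D_def F_def k_def)
  have AE0: "AE x in lborel. x \<noteq> (0 :: real ^ 'd)"
    by (rule AE_lborel_singleton)
  interpret star: prob_space "star_law f l \<omega> :: (real ^ 'd) measure"
    by (rule star)
  \<comment> \<open>\<open>K1\<close> is a Bochner integral, hence possibly 0 by default; that would make the star law the zero measure.\<close>
  have k: "0 < k"
  proof (rule ccontr)
    assume "\<not> 0 < k"
    then have "D x * F x / k \<le> 0" if "x \<noteq> 0" for x
      using that D_pos'[of x] F_nonneg[of x] by (simp add: divide_nonneg_nonpos)
    then have "(\<integral>\<^sup>+x. ennreal (D x * F x / k) \<partial>lborel) = (\<integral>\<^sup>+x. 0 \<partial>(lborel :: (real ^ 'd) measure))"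
      by (intro nn_integral_cong_AE eventually_mono[OF AE0]) (simp add: ennreal_neg)
    then show False
      using star.emeasure_space_1 by (simp add: star_eq emeasure_density)
  qed
  have change: "(\<integral>\<^sup>+x. ennreal (k / D x) * H x \<partial>star_law f l \<omega>) = (\<integral>\<^sup>+x. H x \<partial>spherical_law f 0)"
    if [measurable]: "H \<in> borel_measurable borel" for H :: "real ^ 'd \<Rightarrow> ennreal"
  proof -
    have "(\<integral>\<^sup>+x. ennreal (k / D x) * H x \<partial>star_law f l \<omega>)
        = (\<integral>\<^sup>+x. ennreal (D x * F x / k) * (ennreal (k / D x) * H x) \<partial>lborel)"
      by (simp add: star_eq nn_integral_density)
    also have "\<dots> = (\<integral>\<^sup>+x. ennreal (F x) * H x \<partial>lborel)"
    proof (intro nn_integral_cong_AE eventually_mono[OF AE0])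
      fix x :: "real ^ 'd" assume "x \<noteq> 0"
      then have "ennreal (D x * F x / k) * ennreal (k / D x) = ennreal (F x)"
        using D_pos'[of x] F_nonneg[of x] k by (simp flip: ennreal_mult)
      then show "ennreal (D x * F x / k) * (ennreal (k / D x) * H x) = ennreal (F x) * H x"
        by (simp flip: mult.assoc)
    qed
    also have "\<dots> = (\<integral>\<^sup>+x. H x \<partial>spherical_law f 0)"
      by (simp add: spherical_law_def F_def nn_integral_density)
    finally show ?thesis .
  qed
  have "(\<integral>\<^sup>+x. ennreal (w x) \<partial>spherical_law f 0) = (\<integral>\<^sup>+x. ennreal (k / D x) * ennreal (w x) \<partial>star_law f l \<omega>)"
    by (rule change[symmetric]) measurable
  also have "\<dots> \<le> (\<integral>\<^sup>+x. ennreal (k / D x) \<partial>star_law f l \<omega>) * (\<integral>\<^sup>+x. ennreal (w x) \<partial>star_law f l \<omega>)"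
  proof (rule star.nn_integral_chebyshev[where S = "- {0}"])
    show "AE x in star_law f l \<omega>. x \<in> - {0 :: real ^ 'd}"
      unfolding star_eq using AE0 by (subst AE_density) auto
    let ?A = "\<lambda>x. ennreal (k / D x)" and ?B = "\<lambda>x. ennreal (w x)"
    have mono: "?A x * ?B x + ?A y * ?B y \<le> ?A x * ?B y + ?A y * ?B x"
      if "x \<noteq> 0" "y \<noteq> 0" "norm x \<le> norm y" for x y
      using that k D_pos' by (intro ennreal_rearrangement ennreal_leI w_antimono divide_left_mono D_antimono') auto
    show "?A x * ?B x + ?A y * ?B y \<le> ?A x * ?B y + ?A y * ?B x"
      if "x \<in> - {0}" "y \<in> - {0}" for x y
      using mono[of x y] mono[of y x] that by (cases "norm x \<le> norm y") (simp_all add: add.commute)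
  qed (auto simp: star_eq)
  also have "(\<integral>\<^sup>+x. ennreal (k / D x) \<partial>star_law f l \<omega>) = 1"
    using change[of "\<lambda>_. 1"] mass by (simp add: spherical_law_def)
  finally show ?thesis by simp
qed

text \<open>
  The expansion of the square leaves \<open>a\<^sup>2 * w\<^sup>2 * (norm x)\<^sup>2\<close>, which the second
  condition on \<open>w\<close> bounds by \<open>a\<^sup>2 * w\<close>.
\<close>

lemma shrinkage_loss_excess:
  fixes x \<theta> :: "real ^ 'd"
  assumes omega: "0 \<le> \<omega>" "\<omega> < 1" and w: "0 \<le> w" "w * (norm x)\<^sup>2 \<le> 1"
  shows "balanced_loss \<omega> (\<lambda>t. t) x \<theta> (x - (a * (1 - \<omega>) * w) *\<^sub>R x)
    \<le> balanced_loss \<omega> (\<lambda>t. t) x \<theta> x + (1 - \<omega>)\<^sup>2 * (a\<^sup>2 * w - 2 * a * (w * (x \<bullet> (x - \<theta>))))"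
proof -
  define b where "b = a * (1 - \<omega>) * w"
  have "(norm (x - b *\<^sub>R x - \<theta>))\<^sup>2 = (norm (x - \<theta>))\<^sup>2 - 2 * b * (x \<bullet> (x - \<theta>)) + b\<^sup>2 * (norm x)\<^sup>2"
    unfolding power2_norm_eq_inner
    by (simp add: inner_diff_left inner_diff_right inner_commute power2_eq_square algebra_simps)
  then have "balanced_loss \<omega> (\<lambda>t. t) x \<theta> (x - b *\<^sub>R x)
      = balanced_loss \<omega> (\<lambda>t. t) x \<theta> x + (b\<^sup>2 * (norm x)\<^sup>2 - 2 * (1 - \<omega>) * b * (x \<bullet> (x - \<theta>)))"
    by (simp only: balanced_loss_def) (simp add: power_mult_distrib, simp add: algebra_simps)
  also have "b\<^sup>2 * (norm x)\<^sup>2 - 2 * (1 - \<omega>) * b * (x \<bullet> (x - \<theta>))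
      = (1 - \<omega>)\<^sup>2 * (a\<^sup>2 * (w * (w * (norm x)\<^sup>2)) - 2 * a * (w * (x \<bullet> (x - \<theta>))))"
    by (simp add: b_def power2_eq_square algebra_simps)
  also have "\<dots> \<le> (1 - \<omega>)\<^sup>2 * (a\<^sup>2 * w - 2 * a * (w * (x \<bullet> (x - \<theta>))))"
    using w by (intro mult_left_mono diff_right_mono) (auto intro: mult_left_le)
  finally show ?thesis by (simp add: b_def)
qed

theorem corollary3:
  fixes f l r :: "real \<Rightarrow> real"
    and \<omega> a :: real
  assumes dim: "CARD('d::finite) \<ge> 3"
    and f_meas: "(\<lambda>x :: real ^ 'd. f ((norm x)\<^sup>2)) \<in> borel_measurable borel"
    and f_nonneg: "\<forall>t\<ge>0. 0 \<le> f t"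
    and mixture: "normal_scale_mixture (spherical_law f :: real ^ 'd \<Rightarrow> (real ^ 'd) measure)"
    and omega: "0 \<le> \<omega>" "\<omega> < 1"
    and l_nonneg: "\<forall>t\<ge>0. 0 \<le> l t"
    and l_diff: "\<forall>t>0. l differentiable (at t)"
    and l_deriv_pos: "\<forall>t>0. 0 < deriv l t"
    and l_deriv_cm: "completely_monotone (deriv l)"
    and star_density: "prob_space (star_law f l \<omega> :: (real ^ 'd) measure)"
    and star_moment: "integrable (star_law f l \<omega>) (\<lambda>x :: real ^ 'd. (norm x)\<^sup>2)"
    and star_inverse_moment: "integrable (star_law f l \<omega>) (\<lambda>x :: real ^ 'd. 1 / (norm x)\<^sup>2)"
    and r_bounds: "\<forall>t>0. 0 \<le> r t \<and> r t \<le> 1"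
    and r_nonzero: "\<exists>t>0. r t \<noteq> 0"
    and r_diff: "\<forall>t>0. r differentiable (at t)"
    and r_deriv: "\<forall>t>0. 0 \<le> deriv r t"
    and r_over_t_deriv: "\<forall>t>0. deriv (\<lambda>s. r s / s) t \<le> 0"
    and a_pos: "0 < a"
    and a_upper: "a < 2 / (\<integral>x. 1 / (norm (x :: real ^ 'd))\<^sup>2 \<partial>star_law f l \<omega>)"
    and finite_risk_X:
      "\<forall>\<theta> :: real ^ 'd. risk (spherical_law f) (balanced_loss \<omega> (\<lambda>t. t)) \<theta> (\<lambda>x. x) < \<infinity>"
    and finite_risk_shrinkage:
      "\<forall>\<theta> :: real ^ 'd. risk (spherical_law f) (balanced_loss \<omega> (\<lambda>t. t)) \<theta>
         (shrinkage (a * (1 - \<omega>)) r) < \<infinity>"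
  shows "dominates (spherical_law f) (balanced_loss \<omega> (\<lambda>t. t))
           (shrinkage (a * (1 - \<omega>)) r) (\<lambda>x :: real ^ 'd. x)"
proof -
  have l'_pos: "0 < deriv l t" if "0 < t" for t
    using l_deriv_pos that by simp
  have l'_diff: "deriv l differentiable (at t)" and l''_nonpos: "deriv (deriv l) t \<le> 0" if "0 < t" for t
    using l_deriv_cm[unfolded completely_monotone_def, rule_format, OF that, of 0]
      l_deriv_cm[unfolded completely_monotone_def, rule_format, OF that, of 1] by simp_all
  have l'_antimono: "deriv l t \<le> deriv l s" if "0 < s" "s \<le> t" for s t
  proof (rule DERIV_nonpos_imp_nonincreasing[of s t "deriv l"])
    fix u assume "s \<le> u" "u \<le> t"
    then show "\<exists>y. (deriv l has_real_derivative y) (at u) \<and> y \<le> 0"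
      using that l'_diff[of u] l''_nonpos[of u] by (auto simp: DERIV_deriv_iff_real_differentiable[symmetric])
  qed (use that in auto)
  have r_mono: "r s \<le> r t" if "0 < s" "s \<le> t" for s t
  proof (rule DERIV_nonneg_imp_nondecreasing[of s t r])
    fix u assume "s \<le> u" "u \<le> t"
    then have "0 < u" using that by simp
    then show "\<exists>y. (r has_real_derivative y) (at u) \<and> 0 \<le> y"
      using r_diff r_deriv by (auto simp: DERIV_deriv_iff_real_differentiable[symmetric])
  qed (use that in auto)
  have r_ratio: "r t / t \<le> r s / s" if "0 < s" "s \<le> t" for s t
  proof (rule DERIV_nonpos_imp_nonincreasing[of s t "\<lambda>u. r u / u"])
    fix u assume "s \<le> u" "u \<le> t"
    then have u: "0 < u" using that by simp
    then have "(\<lambda>u. r u / u) differentiable (at u)"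
      using r_diff by (intro differentiable_divide) auto
    then show "\<exists>y. ((\<lambda>u. r u / u) has_real_derivative y) (at u) \<and> y \<le> 0"
      using r_over_t_deriv u by (auto simp: DERIV_deriv_iff_real_differentiable[symmetric])
  qed (use that in auto)
  \<comment> \<open>The value of \<open>r\<close> at \<open>0\<close> is unrestricted; 0 keeps \<open>\<rho>\<close> monotone and does not change the estimator.\<close>
  define \<rho> where "\<rho> t = (if 0 < t then r t else 0)" for t
  obtain G :: "real measure" where G: "prob_space G" "sets G = sets borel" "AE v in G. 0 < v"
    "\<And>\<theta> A. A \<in> sets borel \<Longrightarrow>
      emeasure (spherical_law f (\<theta> :: real ^ 'd)) A = (\<integral>\<^sup>+v. emeasure (normal_law \<theta> v) A \<partial>G)"
    using mixture unfolding normal_scale_mixture_def by blast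
  interpret G: prob_space G by (rule G)
  interpret shrinkage_problem G "spherical_law f :: real ^ 'd \<Rightarrow> (real ^ 'd) measure" \<rho>
  proof unfold_locales
    show "mono \<rho>"
      using r_mono r_bounds by (auto simp: \<rho>_def intro!: monoI)
    show "0 \<le> \<rho> t" "\<rho> t \<le> 1" for t
      using r_bounds by (auto simp: \<rho>_def)
    show "\<exists>t. \<rho> t \<noteq> 0"
      using r_nonzero by (auto simp: \<rho>_def intro: exI)
  qed (use G dim r_ratio in \<open>auto simp: \<rho>_def spherical_law_def\<close>)
  let ?c = "a * (1 - \<omega>)"
  define d where "d = real CARD('d) - 2"
  define m where "m = (\<integral>x. 1 / (norm (x :: real ^ 'd))\<^sup>2 \<partial>star_law f l \<omega>)"
  have d: "0 < d" using dim by (simp add: d_def)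
  have m: "0 \<le> m" by (simp add: m_def)
  \<comment> \<open>The case \<open>m = 0\<close> contradicts \<open>a_upper\<close>, which then reads \<open>a < 2 / 0 = 0\<close>.\<close>
  then have am: "a * m < 2"
    using a_pos a_upper by (cases "m = 0") (auto simp: m_def[symmetric] field_simps)

  have "continuous_on (- {0}) (\<lambda>x :: real ^ 'd. deriv l ((1 - \<omega>) * (norm x)\<^sup>2))"
  proof (rule continuous_on_compose2[of "{0<..}" "deriv l"])
    show "continuous_on {0<..} (deriv l)"
      using l'_diff by (auto intro!: continuous_at_imp_continuous_on differentiable_imp_continuous_within)
  qed (use omega in \<open>auto intro!: continuous_intros simp: zero_less_mult_iff\<close>)
  from borel_measurable_continuous_on_if[OF _ _ this, of "\<lambda>x. deriv l ((1 - \<omega>) * (norm x)\<^sup>2)"]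
  have l'_meas: "(\<lambda>x :: real ^ 'd. deriv l ((1 - \<omega>) * (norm x)\<^sup>2)) \<in> borel_measurable borel"
    by simp
  have inverse_antimono: "1 / (norm y)\<^sup>2 \<le> 1 / (norm x)\<^sup>2" if "x \<noteq> 0" "norm x \<le> norm y" for x y :: "real ^ 'd"
    using that by (intro frac_le power_mono) auto
  have "ennreal (1 / d) * mean_precision = (\<integral>\<^sup>+x. ennreal (1 / (norm x)\<^sup>2) \<partial>spherical_law f (0 :: real ^ 'd))"
    using inverse_moment_origin[OF dim] by (simp add: d_def)
  also have "\<dots> \<le> (\<integral>\<^sup>+x. ennreal (1 / (norm (x :: real ^ 'd))\<^sup>2) \<partial>star_law f l \<omega>)"
    using emeasure_space_P[of 0] omega
    by (intro nn_integral_spherical_le_star f_meas l'_meas l'_pos l'_antimono star_density f_nonneg[rule_format]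
        inverse_antimono) (auto simp: spherical_law_def)
  also have "\<dots> = ennreal m"
    unfolding m_def using star_inverse_moment by (intro nn_integral_eq_integral) auto
  finally have le_m: "ennreal (1 / d) * mean_precision \<le> ennreal m" .
  have "mean_precision = ennreal d * (ennreal (1 / d) * mean_precision)"
    using d by (simp flip: mult.assoc ennreal_mult)
  also have "\<dots> \<le> ennreal d * ennreal m"
    using le_m by (rule mult_left_mono) simp
  finally have "ennreal a * mean_precision \<le> ennreal a * (ennreal d * ennreal m)"
    by (rule mult_left_mono) simp
  also have "\<dots> = ennreal (d * (a * m))"
    using a_pos d m by (simp add: ac_simps flip: ennreal_mult)
  also have "\<dots> < ennreal (2 * d)"
    using am a_pos d m by (simp add: ennreal_less_iff)
  finally have precision: "ennreal a * mean_precision < ennreal (2 * (real CARD('d) - 2))"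
    by (simp add: d_def)

  have shrinkage_eq: "shrinkage ?c r x = x - (?c * weight x) *\<^sub>R x" for x :: "real ^ 'd"
    by (cases "x = 0") (simp_all add: shrinkage_def weight_def \<rho>_def scaleR_diff_left)
  have weight_norm: "weight x * (norm x)\<^sup>2 \<le> 1" for x :: "real ^ 'd"
    by (simp add: weight_def bounds)
  have "risk (spherical_law f) (balanced_loss \<omega> (\<lambda>t. t)) \<theta> (shrinkage ?c r)
      < risk (spherical_law f) (balanced_loss \<omega> (\<lambda>t. t)) \<theta> (\<lambda>x. x)" for \<theta> :: "real ^ 'd"
    unfolding risk_def shrinkage_eq
  proof (rule shrinkage_risk_less[OF a_pos _ precision, where c = "(1 - \<omega>)\<^sup>2"])
    show "0 < (1 - \<omega>)\<^sup>2" using omega by simp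
    show "(\<lambda>x. balanced_loss \<omega> (\<lambda>t. t) x \<theta> x) \<in> borel_measurable borel"
      "(\<lambda>x. balanced_loss \<omega> (\<lambda>t. t) x \<theta> (x - (?c * weight x) *\<^sub>R x)) \<in> borel_measurable borel"
      unfolding balanced_loss_def by measurable
    show "balanced_loss \<omega> (\<lambda>t. t) x \<theta> (x - (?c * weight x) *\<^sub>R x)
        \<le> balanced_loss \<omega> (\<lambda>t. t) x \<theta> x + (1 - \<omega>)\<^sup>2 * (a\<^sup>2 * weight x - 2 * a * cross \<theta> x)" for x
      unfolding cross_def using omega weight_nonneg weight_norm by (rule shrinkage_loss_excess)
    show "(\<integral>\<^sup>+x. ennreal (balanced_loss \<omega> (\<lambda>t. t) x \<theta> x) \<partial>spherical_law f \<theta>) < \<infinity>"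
      using finite_risk_X by (simp add: risk_def)
  qed (use omega in \<open>auto simp: balanced_loss_def\<close>)
  then show ?thesis
    unfolding dominates_def by (auto intro: less_imp_le)
qed

end
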